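(* Let $\mathfrak g$ be a complex semisimple Lie algebra, $\mathfrak t$ a Cartan subalgebra, $\mathfrak h\supset\mathfrak t$ a Levi subalgebra of $\mathfrak g$, and $\mathbf S$ the associated spin module. Let $I_1,\ldots,I_k\subset\Delta$ be subsets of simple roots such that $I_i\perp I_j$ whenever $i\ne j$. Assume that $A=\bigcup_{j=1}^kA_j$ where $A_j\subset\Phi^+_{I_j}(\mathfrak q)$ for each $j$. Then $$\mathrm{mult}_{\mathbf S}(\mu(A))=\prod_{j=1}^k\mathrm{mult}_{\mathbf S}(\mu(A_j)).$$
   Context: Let $\Phi$ be the set of $\mathfrak t$-roots of $\mathfrak g$, $\Phi^+$ a positive system and $\Delta$ its simple roots. Let $\Phi(\mathfrak h)\subset\Phi$ be the roots of $\mathfrak h$, $\mathfrak q$ the orthogonal complement of $\mathfrak h$ in $\mathfrak g$ for the Killing form, $\Phi(\mathfrak q)=\Phi\setminus\Phi(\mathfrak h)$ its roots, and $\Phi^+(\mathfrak q)=\Phi^+\cap\Phi(\mathfrak q)$. The spin module is $\mathbf S=\bigwedge\mathfrak u^+$ with $\mathfrak u^+=\bigoplus_{\alpha\in\Phi^+(\mathfrak q)}\mathfrak g_\alpha$ and $\mathfrak h$ acting through $\mathfrak h\xrightarrow{\mathrm{ad}}\mathfrak{so}(\mathfrak q)\subset\mathbf C(\mathfrak q)\to\mathrm{End}(\mathbf S)$ (Clifford multiplication). Its weights are $\mu(A)=\frac12\big(\sum_{\alpha\in\Phi^+(\mathfrak q)\setminus A}\alpha-\sum_{\alpha\in A}\alpha\big)$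 for $A\subset\Phi^+(\mathfrak q)$, and the multiplicity of $\mu\in\mathfrak t^*$ is $\mathrm{mult}_{\mathbf S}(\mu)=\#\{A\subset\Phi^+(\mathfrak q):\mu(A)=\mu\}$. For $I\subset\Delta$, $\Phi^+_I(\mathfrak q)=\Phi^+\cap\langle I\rangle\cap\Phi^+(\mathfrak q)$, where $\langle I\rangle$ is the linear span of $I$. Orthogonality $\perp$ is with respect to the bilinear form on $\mathfrak t^*$ induced by the Killing form. *)

theory Defs
  imports Complex_Main "HOL-Library.Function_Algebras"
begin

section \<open>Finite-dimensional complex Lie algebras\<close>

class complex_vector_space = ab_group_add +
  fixes scaleC :: "complex \<Rightarrow> 'a \<Rightarrow> 'a"  (infixr \<open>*\<^sub>c\<close> 75)
  assumes scaleC_right_distrib: "a *\<^sub>c (x + y) = a *\<^sub>c x + a *\<^sub>c y"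
    and scaleC_left_distrib: "(a + b) *\<^sub>c x = a *\<^sub>c x + b *\<^sub>c x"
    and scaleC_scaleC: "a *\<^sub>c b *\<^sub>c x = (a * b) *\<^sub>c x"
    and scaleC_one: "1 *\<^sub>c x = x"

global_interpretation cvec: vector_space "scaleC :: complex \<Rightarrow> 'a \<Rightarrow> 'a::complex_vector_space"
  by unfold_locales
    (simp_all add: scaleC_right_distrib scaleC_left_distrib scaleC_scaleC scaleC_one)

class complex_lie_algebra = complex_vector_space +
  fixes lie :: "'a \<Rightarrow> 'a \<Rightarrow> 'a"
  assumes lie_add_left: "lie (x + y) z = lie x z + lie y z"
    and lie_add_right: "lie x (y + z) = lie x y + lie x z"
    and lie_scaleC_left: "lie (a *\<^sub>c x) y = a *\<^sub>c lie x y"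
    and lie_scaleC_right: "lie x (a *\<^sub>c y) = a *\<^sub>c lie x y"
    and lie_self: "lie x x = 0"
    and jacobi: "lie x (lie y z) + lie y (lie z x) + lie z (lie x y) = 0"

class fd_complex_lie_algebra = complex_lie_algebra +
  assumes finite_dimensional: "\<exists>B. finite B \<and> (\<forall>x. \<exists>c. x = (\<Sum>b\<in>B. c b *\<^sub>c b))"


section \<open>Subalgebras, ideals, solvability, nilpotency\<close>

definition lie_subalgebra :: "'a::complex_lie_algebra set \<Rightarrow> bool" where
  "lie_subalgebra S \<longleftrightarrow> cvec.subspace S \<and> (\<forall>x\<in>S. \<forall>y\<in>S. lie x y \<in> S)"

definition lie_ideal :: "'a::complex_lie_algebra set \<Rightarrow> 'a set \<Rightarrow> bool" where
  "lie_ideal I S \<longleftrightarrow> cvec.subspace I \<and> I \<subseteq> S \<and> (\<forall>x\<in>S. \<forall>y\<in>I. lie x y \<in> I)"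

definition lie_product :: "'a::complex_lie_algebra set \<Rightarrow> 'a set \<Rightarrow> 'a set" where
  "lie_product S T = cvec.span {lie x y |x y. x \<in> S \<and> y \<in> T}"

primrec derived_series :: "'a::complex_lie_algebra set \<Rightarrow> nat \<Rightarrow> 'a set" where
  "derived_series S 0 = S"
| "derived_series S (Suc n) = lie_product (derived_series S n) (derived_series S n)"

primrec lower_central_series :: "'a::complex_lie_algebra set \<Rightarrow> nat \<Rightarrow> 'a set" where
  "lower_central_series S 0 = S"
| "lower_central_series S (Suc n) = lie_product S (lower_central_series S n)"

definition lie_solvable :: "'a::complex_lie_algebra set \<Rightarrow> bool" where
  "lie_solvable S \<longleftrightarrow> (\<exists>n. derived_series S n = {0})"

definition lie_nilpotent :: "'a::complex_lie_algebra set \<Rightarrow> bool" where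
  "lie_nilpotent S \<longleftrightarrow> (\<exists>n. lower_central_series S n = {0})"

definition lie_abelian :: "'a::complex_lie_algebra set \<Rightarrow> bool" where
  "lie_abelian S \<longleftrightarrow> (\<forall>x\<in>S. \<forall>y\<in>S. lie x y = 0)"

text \<open>The ambient Lie algebra is the whole type, so semisimplicity is a property of
  the type \<^typ>\<open>'a\<close>; the argument only serves to name that type.\<close>

definition semisimple_lie :: "'a::fd_complex_lie_algebra itself \<Rightarrow> bool" where
  "semisimple_lie _ \<longleftrightarrow> (\<forall>R::'a set. lie_ideal R UNIV \<and> lie_solvable R \<longrightarrow> R = {0})"


section \<open>Cartan subalgebras and Levi subalgebras\<close>

definition diagonalizable :: "('a::complex_vector_space \<Rightarrow> 'a) \<Rightarrow> bool" where
  "diagonalizable f \<longleftrightarrow> cvec.span {x. \<exists>c. f x = c *\<^sub>c x} = UNIV"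

text \<open>Cartan subalgebras in the form that is usual for complex semisimple Lie algebras:
  maximal abelian subalgebras all of whose elements are ad-semisimple.\<close>

definition cartan_subalgebra :: "'a::fd_complex_lie_algebra set \<Rightarrow> bool" where
  "cartan_subalgebra \<tt> \<longleftrightarrow>
     lie_subalgebra \<tt> \<and> lie_abelian \<tt> \<and>
     (\<forall>\<ss>. lie_subalgebra \<ss> \<and> lie_abelian \<ss> \<and> \<tt> \<subseteq> \<ss> \<longrightarrow> \<ss> = \<tt>) \<and>
     (\<forall>x\<in>\<tt>. diagonalizable (lie x))"

definition borel_subalgebra :: "'a::fd_complex_lie_algebra set \<Rightarrow> bool" where
  "borel_subalgebra \<bb> \<longleftrightarrow>
     lie_subalgebra \<bb> \<and> lie_solvable \<bb> \<and>
     (\<forall>\<ss>. lie_subalgebra \<ss> \<and> lie_solvable \<ss> \<and> \<bb> \<subseteq> \<ss> \<longrightarrow> \<ss> = \<bb>)"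

definition parabolic_subalgebra :: "'a::fd_complex_lie_algebra set \<Rightarrow> bool" where
  "parabolic_subalgebra \<pp> \<longleftrightarrow>
     lie_subalgebra \<pp> \<and> (\<exists>\<bb>. borel_subalgebra \<bb> \<and> \<bb> \<subseteq> \<pp>)"

text \<open>The sum of all nilpotent ideals, which is the largest nilpotent ideal.\<close>

definition nilradical :: "'a::fd_complex_lie_algebra set \<Rightarrow> 'a set" where
  "nilradical \<pp> = cvec.span (\<Union>{\<nn>. lie_ideal \<nn> \<pp> \<and> lie_nilpotent \<nn>})"

text \<open>\<open>\<hh>\<close> is reductive in the ambient Lie algebra: the latter is a semisimple
  \<open>\<hh>\<close>-module under the adjoint action.\<close>

definition reductive_in :: "'a::fd_complex_lie_algebra set \<Rightarrow> bool" where
  "reductive_in \<hh> \<longleftrightarrow>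
     (\<forall>V. cvec.subspace V \<and> (\<forall>x\<in>\<hh>. \<forall>v\<in>V. lie x v \<in> V) \<longrightarrow>
       (\<exists>W. cvec.subspace W \<and> (\<forall>x\<in>\<hh>. \<forall>w\<in>W. lie x w \<in> W) \<and>
            V \<inter> W = {0} \<and> cvec.span (V \<union> W) = UNIV))"

text \<open>Levi factors of parabolic subalgebras (not the Levi factors of the
  Levi-Malcev decomposition).\<close>

definition levi_subalgebra :: "'a::fd_complex_lie_algebra set \<Rightarrow> bool" where
  "levi_subalgebra \<hh> \<longleftrightarrow>
     lie_subalgebra \<hh> \<and> reductive_in \<hh> \<and>
     (\<exists>\<pp>. parabolic_subalgebra \<pp> \<and> \<hh> \<inter> nilradical \<pp> = {0} \<and>
          cvec.span (\<hh> \<union> nilradical \<pp>) = \<pp>)"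


section \<open>Killing form and the dual of a Cartan subalgebra\<close>

text \<open>The choice of the basis does not matter.\<close>

definition endo_trace :: "('a::fd_complex_lie_algebra \<Rightarrow> 'a) \<Rightarrow> complex" where
  "endo_trace f = (let B = (SOME B. cvec.independent B \<and> cvec.span B = UNIV)
              in \<Sum>b\<in>B. cvec.representation B (f b) b)"

definition killing :: "'a::fd_complex_lie_algebra \<Rightarrow> 'a \<Rightarrow> complex" where
  "killing x y = endo_trace (\<lambda>z. lie x (lie y z))"

text \<open>Elements of the dual of \<open>\<tt>\<close> are functions on the ambient type that are linear on
  \<open>\<tt>\<close> and vanish off \<open>\<tt>\<close>. Thus two functionals on \<open>\<tt>\<close> agree iff they are equal as
  functions, and the vector space operations are the pointwise ones.\<close>

definition dual :: "'a::complex_vector_space set \<Rightarrow> ('a \<Rightarrow> complex) set" where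
  "dual \<tt> = {l. (\<forall>x\<in>\<tt>. \<forall>y\<in>\<tt>. l (x + y) = l x + l y) \<and>
                 (\<forall>c. \<forall>x\<in>\<tt>. l (c *\<^sub>c x) = c * l x) \<and>
                 (\<forall>x. x \<notin> \<tt> \<longrightarrow> l x = 0)}"

global_interpretation functional: vector_space "\<lambda>(c::complex) (f::'a \<Rightarrow> complex) x. c * f x"
  by unfold_locales (simp_all add: fun_eq_iff algebra_simps)

text \<open>The element of \<open>\<tt>\<close> representing a functional through the Killing form, and the form
  on the dual of \<open>\<tt>\<close> obtained by transport.\<close>

definition killing_rep :: "'a::fd_complex_lie_algebra set \<Rightarrow> ('a \<Rightarrow> complex) \<Rightarrow> 'a" where
  "killing_rep \<tt> l = (THE h. h \<in> \<tt> \<and> (\<forall>x\<in>\<tt>. killing h x = l x))"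

definition dual_form ::
  "'a::fd_complex_lie_algebra set \<Rightarrow> ('a \<Rightarrow> complex) \<Rightarrow> ('a \<Rightarrow> complex) \<Rightarrow> complex" where
  "dual_form \<tt> l m = killing (killing_rep \<tt> l) (killing_rep \<tt> m)"


section \<open>Roots\<close>

text \<open>The \<open>\<tt>\<close>-roots of a subspace \<open>V\<close>, for instance \<open>V = UNIV\<close> or a subalgebra
  containing \<open>\<tt>\<close>.\<close>

definition roots :: "'a::fd_complex_lie_algebra set \<Rightarrow> 'a set \<Rightarrow> ('a \<Rightarrow> complex) set" where
  "roots \<tt> V = {\<alpha> \<in> dual \<tt>. \<alpha> \<noteq> 0 \<and> (\<exists>x\<in>V. x \<noteq> 0 \<and> (\<forall>h\<in>\<tt>. lie h x = \<alpha> h *\<^sub>c x))}"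

definition positive_system :: "('a \<Rightarrow> complex) set \<Rightarrow> ('a \<Rightarrow> complex) set \<Rightarrow> bool" where
  "positive_system \<Phi> P \<longleftrightarrow>
     \<Phi> = P \<union> uminus ` P \<and> P \<inter> uminus ` P = {} \<and>
     (\<forall>\<alpha>\<in>P. \<forall>\<beta>\<in>P. \<alpha> + \<beta> \<in> \<Phi> \<longrightarrow> \<alpha> + \<beta> \<in> P)"

definition simple_roots :: "('a \<Rightarrow> complex) set \<Rightarrow> ('a \<Rightarrow> complex) set" where
  "simple_roots P = {\<alpha> \<in> P. \<not> (\<exists>\<beta>\<in>P. \<exists>\<gamma>\<in>P. \<alpha> = \<beta> + \<gamma>)}"

text \<open>The set \<open>\<Phi>(\<qq>)\<close>, where \<open>\<qq>\<close> is the orthogonal complement of \<open>\<hh>\<close> for the Killing form,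
  and the positive roots in it.\<close>

definition roots_q :: "'a::fd_complex_lie_algebra set \<Rightarrow> 'a set \<Rightarrow> ('a \<Rightarrow> complex) set" where
  "roots_q \<tt> \<hh> = roots \<tt> UNIV - roots \<tt> \<hh>"

definition pos_roots_q ::
  "'a::fd_complex_lie_algebra set \<Rightarrow> 'a set \<Rightarrow> ('a \<Rightarrow> complex) set \<Rightarrow> ('a \<Rightarrow> complex) set" where
  "pos_roots_q \<tt> \<hh> P = P \<inter> roots_q \<tt> \<hh>"

definition pos_roots_q_span ::
  "'a::fd_complex_lie_algebra set \<Rightarrow> 'a set \<Rightarrow> ('a \<Rightarrow> complex) set \<Rightarrow> ('a \<Rightarrow> complex) set
     \<Rightarrow> ('a \<Rightarrow> complex) set" where
  "pos_roots_q_span \<tt> \<hh> P I = P \<inter> functional.span I \<inter> pos_roots_q \<tt> \<hh> P"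


section \<open>Weights of the spin module\<close>

text \<open>For \<open>\<uu>\<^sup>+\<close> the sum of the root spaces \<open>\<gg>\<^sub>\<alpha>\<close> with \<open>\<alpha>\<close> in
  \<^term>\<open>pos_roots_q \<tt> \<hh> P\<close>, the spin module is \<open>\<And>\<uu>\<^sup>+\<close>. Its weights are the
  \<open>\<mu>(A) = \<close>\<^term>\<open>spin_weight \<tt> \<hh> P A\<close> for sets \<open>A\<close> of roots in
  \<^term>\<open>pos_roots_q \<tt> \<hh> P\<close>, the set \<open>A\<close> corresponding to a product of root vectors. The
  multiplicity of a weight is defined through this parametrization, as the number of sets
  \<open>A\<close> with that weight; functionals that are not weights get multiplicity 0.\<close>

definition spin_weight ::
  "'a::fd_complex_lie_algebra set \<Rightarrow> 'a set \<Rightarrow> ('a \<Rightarrow> complex) set \<Rightarrow> ('a \<Rightarrow> complex) set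
     \<Rightarrow> ('a \<Rightarrow> complex)" where
  "spin_weight \<tt> \<hh> P A =
     (\<lambda>x. 1/2 * ((\<Sum>\<alpha> \<in> pos_roots_q \<tt> \<hh> P - A. \<alpha> x) - (\<Sum>\<alpha> \<in> A. \<alpha> x)))"

definition spin_mult ::
  "'a::fd_complex_lie_algebra set \<Rightarrow> 'a set \<Rightarrow> ('a \<Rightarrow> complex) set \<Rightarrow> ('a \<Rightarrow> complex) \<Rightarrow> nat" where
  "spin_mult \<tt> \<hh> P \<mu> = card {A. A \<subseteq> pos_roots_q \<tt> \<hh> P \<and> spin_weight \<tt> \<hh> P A = \<mu>}"

end

theory Submission
  imports Defs "HOL-Library.Multiset" "HOL-Library.FuncSet"
begin

text \<open>A set of positive roots has the weight of \<open>A\<close> iff it has the same sum. Simple roots are linearly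
  independent and positive roots are sums of simple ones, so all members of such a set have their support in
  \<open>\<Union>\<^sub>j I\<^sub>j\<close>; as the support of a root is connected, each of them lies in the span of a single \<open>I\<^sub>j\<close>. Hence
  the set splits uniquely into sets with the sums of the \<open>A\<^sub>j\<close>.

  The structure theory of roots is obtained from traces alone: a commutator has trace zero on every sum of
  weight spaces that both of its factors preserve. On a full root string this gives the rationality of the
  inner products, on half a string the closure properties of the root system. Nondegeneracy of the Killing
  form on the Cartan subalgebra comes from Engel's theorem instead of Cartan's criterion.\<close>

section \<open>Traces over parts of a basis\<close>

text \<open>A \<open>positive_system\<close> is only one half of the roots, closed under those sums
  that are roots. No linear functional and no Weyl chamber comes with it, so even the fact that
  positive roots never sum to zero has to be won from inner products. Traces give less than the
  representation theory of sl2: weights at a commutator have rational ratios, but Cartan integers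
  and reflections are not obtained. Rationality suffices, because it turns the Killing form on sums
  of root representatives into sums of rational squares, hence makes it definite. Engel's theorem
  meets the one obstacle that traces on strings leave open: a root vector could lie in the radical
  of the Killing form, and then no commutator would represent its root. The span in
  \<open>pos_roots_q_span\<close> is a complex one, so independence of the simple roots is needed
  over the complex numbers, although all inner products in sight are rational.\<close>

definition partial_trace ::
  "'a::complex_vector_space set \<Rightarrow> 'a set \<Rightarrow> ('a \<Rightarrow> 'a) \<Rightarrow> complex" where
  "partial_trace B C f = (\<Sum>b\<in>C. cvec.representation B (f b) b)"

abbreviation clinear :: "('a::complex_vector_space \<Rightarrow> 'a) \<Rightarrow> bool" where
  "clinear \<equiv> Vector_Spaces.linear (*\<^sub>c) (*\<^sub>c)"

lemma clinear_sum_scale: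
  assumes "clinear f"
  shows "f (\<Sum>b\<in>B. c b *\<^sub>c g b) = (\<Sum>b\<in>B. c b *\<^sub>c f (g b))"
proof -
  interpret Vector_Spaces.linear "(*\<^sub>c)" "(*\<^sub>c)" f by fact
  show ?thesis by (simp add: sum scale)
qed

lemma representation_sum_scale:
  assumes "cvec.independent B" "\<And>c. c \<in> C \<Longrightarrow> g c \<in> cvec.span B"
  shows "cvec.representation B (\<Sum>c\<in>C. r c *\<^sub>c g c) b = (\<Sum>c\<in>C. r c * cvec.representation B (g c) b)"
  using assms by (simp add: cvec.representation_sum cvec.representation_scale cvec.span_scale)

text \<open>Stability of the span of \<open>C\<close> under both maps removes all coordinates
  outside \<open>C\<close>. The partial trace is then the trace of a restriction, and the usual
  double sum over \<open>C\<close> is symmetric in the two maps.\<close>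

lemma partial_trace_commute:
  assumes B: "cvec.independent B" and C: "finite C" "C \<subseteq> B"
    and f: "clinear f" "\<And>b. b \<in> C \<Longrightarrow> f b \<in> cvec.span C"
    and g: "clinear g" "\<And>b. b \<in> C \<Longrightarrow> g b \<in> cvec.span C"
  shows "partial_trace B C (\<lambda>x. f (g x)) = partial_trace B C (\<lambda>x. g (f x))"
proof -
  let ?r = "cvec.representation B"
  have iC: "cvec.independent C" using B C cvec.independent_mono by blast
  have CB: "cvec.span C \<subseteq> cvec.span B" by (rule cvec.span_mono) fact
  have *: "partial_trace B C (\<lambda>x. p (q x)) = (\<Sum>b\<in>C. \<Sum>c\<in>C. ?r (q b) c * ?r (p c) b)"
    if p: "clinear p" "\<And>b. b \<in> C \<Longrightarrow> p b \<in> cvec.span C"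
      and q: "clinear q" "\<And>b. b \<in> C \<Longrightarrow> q b \<in> cvec.span C" for p q
    unfolding partial_trace_def
  proof (rule sum.cong[OF refl])
    fix b assume b: "b \<in> C"
    have "q b = (\<Sum>c\<in>C. ?r (q b) c *\<^sub>c c)"
      using cvec.sum_representation_eq[OF iC q(2)[OF b] C(1) order_refl]
        cvec.representation_extend[OF B q(2)[OF b] C(2)] by simp
    then have "p (q b) = (\<Sum>c\<in>C. ?r (q b) c *\<^sub>c p c)"
      using clinear_sum_scale[OF p(1), of "\<lambda>c. ?r (q b) c" "\<lambda>c. c" C] by simp
    then show "?r (p (q b)) b = (\<Sum>c\<in>C. ?r (q b) c * ?r (p c) b)"
      using p(2) CB by (simp add: representation_sum_scale[OF B] subset_iff)
  qed
  show ?thesis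
    using *[of f g] *[of g f] f g
      sum.swap[of "\<lambda>b c. ?r (g b) c * ?r (f c) b" C C] by (simp add: mult.commute)
qed

text \<open>Expanding each \<open>b\<close> in \<open>C\<close> and each \<open>f c\<close> in
  \<open>B\<close> turns both traces into one mixed double sum. This frees \<open>endo_trace\<close>
  from the basis picked by the choice operator, so that a basis of weight vectors can be
  used.\<close>

lemma partial_trace_basis_change:
  assumes B: "cvec.independent B" "cvec.span B = UNIV" "finite B"
    and C: "cvec.independent C" "cvec.span C = UNIV" "finite C"
    and f: "clinear f"
  shows "partial_trace B B f = partial_trace C C f"
proof -
  let ?r = "cvec.representation B" and ?s = "cvec.representation C"
  have "partial_trace B B f = (\<Sum>b\<in>B. \<Sum>c\<in>C. ?s b c * ?r (f c) b)"
    unfolding partial_trace_def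
  proof (rule sum.cong[OF refl])
    fix b
    have "f b = f (\<Sum>c\<in>C. ?s b c *\<^sub>c c)"
      using cvec.sum_representation_eq[OF C(1) _ C(3) order_refl] C(2) by simp
    then have "f b = (\<Sum>c\<in>C. ?s b c *\<^sub>c f c)" by (simp add: clinear_sum_scale[OF f])
    then show "?r (f b) b = (\<Sum>c\<in>C. ?s b c * ?r (f c) b)"
      by (simp add: representation_sum_scale[OF B(1)] B(2))
  qed
  also have "\<dots> = (\<Sum>c\<in>C. \<Sum>b\<in>B. ?r (f c) b * ?s b c)"
    by (subst sum.swap) (simp add: mult.commute)
  also have "\<dots> = partial_trace C C f"
    unfolding partial_trace_def
  proof (rule sum.cong[OF refl])
    fix c
    have "f c = (\<Sum>b\<in>B. ?r (f c) b *\<^sub>c b)"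
      using cvec.sum_representation_eq[OF B(1) _ B(3) order_refl] B(2) by simp
    then show "(\<Sum>b\<in>B. ?r (f c) b * ?s b c) = ?s (f c) c"
      using representation_sum_scale[OF C(1), of B "\<lambda>b. b" "\<lambda>b. ?r (f c) b" c] C(2) by simp
  qed
  finally show ?thesis .
qed

lemma partial_trace_diff:
  assumes "cvec.independent B" "cvec.span B = UNIV"
  shows "partial_trace B C (\<lambda>x. f x - g x) = partial_trace B C f - partial_trace B C g"
  using assms by (simp add: partial_trace_def cvec.representation_diff sum_subtractf)

lemma partial_trace_scale:
  assumes "cvec.independent B" "cvec.span B = UNIV"
  shows "partial_trace B C (\<lambda>x. c *\<^sub>c f x) = c * partial_trace B C f"
  using assms by (simp add: partial_trace_def cvec.representation_scale sum_distrib_left)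

lemma partial_trace_add:
  assumes "cvec.independent B" "cvec.span B = UNIV"
  shows "partial_trace B C (\<lambda>x. f x + g x) = partial_trace B C f + partial_trace B C g"
  using assms by (simp add: partial_trace_def cvec.representation_add sum.distrib)


section \<open>Elementary properties of the Killing form\<close>

lemma lie_clinear: "clinear (lie (x::'a::complex_lie_algebra))"
  by unfold_locales (simp_all add: lie_add_right lie_scaleC_right)

lemma clinear_comp: "clinear f \<Longrightarrow> clinear g \<Longrightarrow> clinear (\<lambda>x. f (g x))"
  using Vector_Spaces.linear_compose[of "(*\<^sub>c)" "(*\<^sub>c)" g "(*\<^sub>c)" f] by (simp add: comp_def)

lemma lie_anticomm: "lie x y = - lie y (x::'a::complex_lie_algebra)"
proof -
  have "lie (x + y) (x + y) = lie x y + lie y x"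
    by (simp only: lie_add_left lie_add_right) (simp add: lie_self)
  moreover have "lie (x + y) (x + y) = 0" by (rule lie_self)
  ultimately show ?thesis unfolding eq_neg_iff_add_eq_0 by (rule trans[OF sym])
qed

lemma lie_zero_right [simp]: "lie x (0::'a::complex_lie_algebra) = 0"
  using lie_add_right[of x 0 0] by simp

lemma lie_zero_left [simp]: "lie (0::'a::complex_lie_algebra) x = 0"
  using lie_add_left[of 0 0 x] by simp

lemma lie_minus_right: "lie x (- y::'a::complex_lie_algebra) = - lie x y"
  using lie_add_right[of x y "-y"] by (simp add: eq_neg_iff_add_eq_0 add.commute)

lemma lie_diff_right: "lie x (y - z::'a::complex_lie_algebra) = lie x y - lie x z"
  using lie_add_right[of x y "-z"] by (simp add: lie_minus_right)

lemma lie_sum_right: "lie x (\<Sum>i\<in>S. f i::'a::complex_lie_algebra) = (\<Sum>i\<in>S. lie x (f i))"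
  by (induction S rule: infinite_finite_induct) (simp_all add: lie_add_right)

lemma lie_lie: "lie (lie x y) z = lie x (lie y z) - lie y (lie x (z::'a::complex_lie_algebra))"
proof -
  have "lie x (lie y z) + lie y (lie z x) + lie z (lie x y) = 0" by (rule jacobi)
  moreover have "lie y (lie z x) = - lie y (lie x z)"
    by (subst lie_anticomm[of z]) (rule lie_minus_right)
  moreover have "lie z (lie x y) = - lie (lie x y) z" by (rule lie_anticomm)
  ultimately show ?thesis by (simp add: algebra_simps)
qed

lemma lie_derivation: "lie x (lie y z) = lie (lie x y) z + lie y (lie x (z::'a::complex_lie_algebra))"
  by (simp add: lie_lie)

section \<open>The Killing form in a finite basis\<close>

lemma finite_basis_exists:
  obtains F where "finite F" "cvec.independent F" "cvec.span F = (UNIV::'a::fd_complex_lie_algebra set)"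
proof -
  obtain B :: "'a set" where B: "finite B" "\<forall>x. \<exists>c. x = (\<Sum>b\<in>B. c b *\<^sub>c b)"
    using finite_dimensional by blast
  have "x \<in> cvec.span B" for x
  proof -
    obtain c where "x = (\<Sum>b\<in>B. c b *\<^sub>c b)" using B(2) by blast
    then show ?thesis by (simp add: cvec.span_base cvec.span_scale cvec.span_sum)
  qed
  moreover obtain F where F: "F \<subseteq> B" "cvec.independent F" "B \<subseteq> cvec.span F"
    by (rule cvec.maximal_independent_subset)
  moreover have "cvec.span B \<subseteq> cvec.span F"
    using F(3) by (rule cvec.span_minimal) simp
  ultimately show ?thesis
    using that[of F] B(1) finite_subset by blast
qed

lemma independent_finite:
  assumes "cvec.independent (B::'a::fd_complex_lie_algebra set)"
  shows "finite B"
proof -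
  obtain F :: "'a set" where "finite F" "cvec.span F = UNIV"
    by (rule finite_basis_exists)
  then show ?thesis using cvec.independent_span_bound[of F B] assms by simp
qed

lemma endo_trace_basis:
  assumes B: "cvec.independent B" "cvec.span B = (UNIV::'a::fd_complex_lie_algebra set)"
    and f: "clinear f"
  shows "endo_trace f = partial_trace B B f"
proof -
  define C :: "'a set" where "C = (SOME B. cvec.independent B \<and> cvec.span B = UNIV)"
  have "cvec.independent C \<and> cvec.span C = UNIV"
    unfolding C_def by (rule someI[where x=B]) (use B in auto)
  then show ?thesis
    using partial_trace_basis_change[OF _ _ _ B _ f, of C]
    by (simp add: endo_trace_def C_def[symmetric] partial_trace_def[symmetric] independent_finite B)
qed

lemma killing_basis:
  assumes B: "cvec.independent B" "cvec.span B = (UNIV::'a::fd_complex_lie_algebra set)"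
  shows "killing x y = partial_trace B B (\<lambda>z. lie x (lie y z))"
  unfolding killing_def by (rule endo_trace_basis[OF B clinear_comp[OF lie_clinear lie_clinear]])

lemma killing_commute: "killing x y = killing y (x::'a::fd_complex_lie_algebra)"
proof -
  obtain B :: "'a set" where B: "finite B" "cvec.independent B" "cvec.span B = UNIV"
    by (rule finite_basis_exists)
  show ?thesis
    unfolding killing_basis[OF B(2,3)]
    by (rule partial_trace_commute) (simp_all add: B lie_clinear)
qed

lemma killing_add_left: "killing (x + y) z = killing x z + killing y (z::'a::fd_complex_lie_algebra)"
proof -
  obtain B :: "'a set" where B: "finite B" "cvec.independent B" "cvec.span B = UNIV"
    by (rule finite_basis_exists)
  show ?thesis
    unfolding killing_basis[OF B(2,3)] by (simp add: lie_add_left partial_trace_add[OF B(2,3)])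
qed

lemma killing_scale_left: "killing (c *\<^sub>c x) z = c * killing x (z::'a::fd_complex_lie_algebra)"
proof -
  obtain B :: "'a set" where B: "finite B" "cvec.independent B" "cvec.span B = UNIV"
    by (rule finite_basis_exists)
  show ?thesis
    unfolding killing_basis[OF B(2,3)] by (simp add: lie_scaleC_left partial_trace_scale[OF B(2,3)])
qed

lemma killing_scale_right: "killing x (c *\<^sub>c z) = c * killing x (z::'a::fd_complex_lie_algebra)"
  by (metis killing_commute killing_scale_left)

lemma killing_add_right: "killing x (y + z) = killing x y + killing x (z::'a::fd_complex_lie_algebra)"
  by (metis killing_commute killing_add_left)

lemma killing_zero_left [simp]: "killing 0 (z::'a::fd_complex_lie_algebra) = 0"
  using killing_scale_left[of 0 0 z] by simp

lemma killing_zero_right [simp]: "killing z (0::'a::fd_complex_lie_algebra) = 0"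
  using killing_scale_right[of z 0 0] by simp

lemma killing_diff_left: "killing (x - y) z = killing x z - killing y (z::'a::fd_complex_lie_algebra)"
  using killing_add_left[of "x - y" y z] by simp

lemma killing_invariant: "killing (lie x y) z = killing x (lie y (z::'a::fd_complex_lie_algebra))"
proof -
  obtain B :: "'a set" where B: "finite B" "cvec.independent B" "cvec.span B = UNIV"
    by (rule finite_basis_exists)
  let ?t = "partial_trace B B"
  \<comment> \<open>After expansion by \<open>lie_lie\<close> both sides contain the trace of ad x
    ad y ad z; the remaining terms differ by a cyclic rotation.\<close>
  have "?t (\<lambda>w. lie y (lie x (lie z w))) = ?t (\<lambda>w. lie x (lie z (lie y w)))"
    by (rule partial_trace_commute[where f="lie y" and g="\<lambda>w. lie x (lie z w)"])
      (simp_all add: B lie_clinear clinear_comp[OF lie_clinear lie_clinear])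
  then show ?thesis
    unfolding killing_basis[OF B(2,3)]
    by (simp add: lie_lie lie_diff_right partial_trace_diff[OF B(2,3)])
qed

section \<open>Weight spaces of a Cartan subalgebra\<close>

text \<open>Applying T - d to the vanishing sum removes the summand for \<open>d\<close> and
  multiplies the others by the nonzero numbers c - d, which leaves a shorter sum of the same
  kind.\<close>

lemma eigenvectors_sum_zero:
  assumes T: "clinear T" and C: "finite C"
    and w: "\<And>c. c \<in> C \<Longrightarrow> T (w c) = c *\<^sub>c w c" "(\<Sum>c\<in>C. w c) = 0"
  shows "\<forall>c\<in>C. w c = 0"
  using C w
proof (induction C arbitrary: w rule: finite_induct)
  case (insert d C)
  interpret Vector_Spaces.linear "(*\<^sub>c)" "(*\<^sub>c)" T by fact
  have "0 = T (\<Sum>c\<in>insert d C. w c) - d *\<^sub>c (\<Sum>c\<in>insert d C. w c)"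
    unfolding insert.prems(2) by simp
  also have "\<dots> = (\<Sum>c\<in>insert d C. (c - d) *\<^sub>c w c)"
    unfolding sum cvec.scale_sum_right sum_subtractf[symmetric]
    by (rule sum.cong) (simp_all add: insert.prems(1) cvec.scale_left_diff_distrib)
  also have "\<dots> = (\<Sum>c\<in>C. (c - d) *\<^sub>c w c)"
    using insert.hyps by simp
  finally have "\<forall>c\<in>C. (c - d) *\<^sub>c w c = 0"
    by (intro insert.IH) (simp_all add: insert.prems(1) scale mult.commute)
  then have "\<forall>c\<in>C. w c = 0" using insert.hyps by auto
  then show ?case using insert.prems(2) insert.hyps by simp
qed simp

lemma eigenvector_decomposition:
  assumes T: "clinear T" and x: "x \<in> cvec.span {x. \<exists>c. T x = c *\<^sub>c x}"
  shows "\<exists>C w. finite C \<and> (\<forall>c\<in>C. T (w c) = c *\<^sub>c w c) \<and> x = (\<Sum>c\<in>C. w c)"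
  using x
proof (induction rule: cvec.span_induct_alt)
  case base
  then show ?case by (intro exI[of _ "{}"]) simp
next
  case (step r v y)
  interpret Vector_Spaces.linear "(*\<^sub>c)" "(*\<^sub>c)" T by fact
  obtain C w where C: "finite C" "\<forall>c\<in>C. T (w c) = c *\<^sub>c w c" "y = (\<Sum>c\<in>C. w c)"
    using step.IH by blast
  obtain d where d: "T v = d *\<^sub>c v" using step.hyps by blast
  \<comment> \<open>The new vector is merged into the summand of its own eigenvalue, so that there
    remains one summand per eigenvalue, as \<open>eigenvectors_sum_zero\<close> requires. The
    default 0 covers a new eigenvalue \<open>d\<close>.\<close>
  define w' where "w' c = (if c \<in> C then w c else 0) + (if c = d then r *\<^sub>c v else 0)" for c
  have "(\<Sum>c\<in>insert d C. w' c) = (\<Sum>c\<in>C. w c) + r *\<^sub>c v"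
    unfolding w'_def sum.distrib using C(1)
    by (cases "d \<in> C") (simp_all add: sum.delta insert_absorb)
  moreover have "\<forall>c\<in>insert d C. T (w' c) = c *\<^sub>c w' c"
    using C(2) d by (auto simp: w'_def add scale cvec.scale_right_distrib mult.commute)
  ultimately show ?case using C(1,3)
    by (intro exI[of _ "insert d C"] exI[of _ w']) (simp add: add.commute)
qed

text \<open>For \<open>f\<close> in \<open>F\<close>, ad f commutes with ad h, so ad f - d maps
  every ad h-component of \<open>x\<close> into the same eigenspace. If \<open>x\<close> has ad
  f-eigenvalue \<open>d\<close>, these images sum to zero, so each of them vanishes: the ad
  h-components of a common eigenvector for \<open>F\<close> are again common eigenvectors.\<close>

lemma simultaneous_diagonalization:
  fixes F :: "'a::complex_lie_algebra set"
  assumes "finite F" "\<And>h. h \<in> F \<Longrightarrow> diagonalizable (lie h)"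
    and "\<And>h k. h \<in> F \<Longrightarrow> k \<in> F \<Longrightarrow> lie h k = 0"
  shows "cvec.span {x. \<forall>h\<in>F. \<exists>c. lie h x = c *\<^sub>c x} = UNIV"
  using assms
proof (induction F rule: finite_induct)
  case (insert h F)
  let ?E = "{x. \<forall>h\<in>F. \<exists>c. lie h x = c *\<^sub>c x}"
  let ?E' = "{x. \<forall>h\<in>insert h F. \<exists>c. lie h x = c *\<^sub>c x}"
  have "x \<in> cvec.span ?E'" if x: "x \<in> ?E" for x
  proof -
    have "x \<in> cvec.span {x. \<exists>c. lie h x = c *\<^sub>c x}"
      using insert.prems(1)[of h] by (simp add: diagonalizable_def)
    then obtain C w where C: "finite C" "\<forall>c\<in>C. lie h (w c) = c *\<^sub>c w c" "x = (\<Sum>c\<in>C. w c)"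
      using eigenvector_decomposition[OF lie_clinear] by blast
    have "\<exists>d. \<forall>c\<in>C. lie f (w c) = d *\<^sub>c w c" if f: "f \<in> F" for f
    proof -
      obtain d where d: "lie f x = d *\<^sub>c x" using x f by blast
      define v where "v c = lie f (w c) - d *\<^sub>c w c" for c
      have "(\<Sum>c\<in>C. v c) = lie f x - d *\<^sub>c x"
        by (simp add: v_def C(3) lie_sum_right cvec.scale_sum_right sum_subtractf)
      then have s: "(\<Sum>c\<in>C. v c) = 0" using d by simp
      have "lie h (lie f y) = lie f (lie h y)" for y
        using lie_derivation[of h f y] insert.prems(2)[of h f] f by simp
      then have "lie h (v c) = c *\<^sub>c v c" if "c \<in> C" for c
        using C(2) that
        by (simp add: v_def lie_diff_right lie_scaleC_right cvec.scale_right_diff_distrib mult.commute)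
      from eigenvectors_sum_zero[OF lie_clinear C(1) this s] show ?thesis
        by (auto simp: v_def)
    qed
    then have "w c \<in> ?E'" if "c \<in> C" for c using C(2) that by blast
    then show ?thesis unfolding C(3) by (intro cvec.span_sum cvec.span_base)
  qed
  then have "cvec.span ?E \<subseteq> cvec.span ?E'"
    by (intro cvec.span_minimal) auto
  then show ?case using insert by auto
qed simp

section \<open>Weight spaces and functionals on a Cartan subalgebra\<close>

definition weight_space :: "'a::complex_lie_algebra set \<Rightarrow> ('a \<Rightarrow> complex) \<Rightarrow> 'a set" where
  "weight_space \<tt> \<alpha> = {x. \<forall>h\<in>\<tt>. lie h x = \<alpha> h *\<^sub>c x}"

lemma weight_spaceD: "x \<in> weight_space \<tt> \<alpha> \<Longrightarrow> h \<in> \<tt> \<Longrightarrow> lie h x = \<alpha> h *\<^sub>c x"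
  by (simp add: weight_space_def)

lemma weight_space_lie:
  assumes "x \<in> weight_space \<tt> \<alpha>" "y \<in> weight_space \<tt> \<beta>"
  shows "lie x y \<in> weight_space \<tt> (\<alpha> + \<beta>)"
  using assms
  by (simp add: weight_space_def lie_derivation lie_scaleC_left lie_scaleC_right cvec.scale_left_distrib)

lemma weight_space_subspace: "cvec.subspace (weight_space \<tt> \<alpha>)"
  by (simp add: cvec.subspace_def weight_space_def lie_add_right lie_scaleC_right
      cvec.scale_right_distrib mult.commute)

lemma dual_zero: "0 \<in> dual \<tt>" by (simp add: dual_def)

lemma dual_add: "\<alpha> \<in> dual \<tt> \<Longrightarrow> \<beta> \<in> dual \<tt> \<Longrightarrow> \<alpha> + \<beta> \<in> dual \<tt>"
  by (simp add: dual_def algebra_simps)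

lemma dual_scale: "\<alpha> \<in> dual \<tt> \<Longrightarrow> (\<lambda>x. c * \<alpha> x) \<in> dual \<tt>"
  by (simp add: dual_def algebra_simps)

lemma dual_minus: "\<alpha> \<in> dual \<tt> \<Longrightarrow> - \<alpha> \<in> dual \<tt>"
  by (simp add: dual_def)

lemma dual_apply_add: "\<alpha> \<in> dual \<tt> \<Longrightarrow> h \<in> \<tt> \<Longrightarrow> k \<in> \<tt> \<Longrightarrow> \<alpha> (h + k) = \<alpha> h + \<alpha> k"
  by (simp add: dual_def)

lemma dual_apply_scale: "\<alpha> \<in> dual \<tt> \<Longrightarrow> h \<in> \<tt> \<Longrightarrow> \<alpha> (c *\<^sub>c h) = c * \<alpha> h"
  by (simp add: dual_def)

lemma dual_apply_zero: "\<alpha> \<in> dual \<tt> \<Longrightarrow> \<alpha> 0 = 0"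
  using dual_apply_scale[of \<alpha> \<tt> 0 0] by (cases "0 \<in> \<tt>") (auto simp: dual_def)

lemma dual_eqI:
  assumes "\<alpha> \<in> dual \<tt>" "\<beta> \<in> dual \<tt>" "\<And>h. h \<in> \<tt> \<Longrightarrow> \<alpha> h = \<beta> h"
  shows "\<alpha> = \<beta>"
proof
  fix x show "\<alpha> x = \<beta> x" using assms by (cases "x \<in> \<tt>") (auto simp: dual_def)
qed

locale cartan =
  fixes \<tt> :: "'a::fd_complex_lie_algebra set"
  assumes cartan: "cartan_subalgebra \<tt>"
begin

lemma subspace: "cvec.subspace \<tt>"
  using cartan by (simp add: cartan_subalgebra_def lie_subalgebra_def)

lemma abelian: "h \<in> \<tt> \<Longrightarrow> k \<in> \<tt> \<Longrightarrow> lie h k = 0"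
  using cartan by (simp add: cartan_subalgebra_def lie_abelian_def)

text \<open>By maximality: adjoining to \<open>\<tt>\<close> an element that commutes with it gives an abelian subalgebra.\<close>

lemma self_centralizing: "weight_space \<tt> 0 = \<tt>"
proof
  show "\<tt> \<subseteq> weight_space \<tt> 0" by (auto simp: weight_space_def abelian)
  show "weight_space \<tt> 0 \<subseteq> \<tt>"
  proof
    fix x assume "x \<in> weight_space \<tt> 0"
    then have x: "lie h x = 0" if "h \<in> \<tt>" for h using that by (simp add: weight_space_def)
    have x': "lie x h = 0" if "h \<in> \<tt>" for h
      using x[OF that] lie_anticomm[of x h] by simp
    let ?s = "cvec.span (insert x \<tt>)"
    have sp: "\<exists>k. \<exists>h\<in>\<tt>. y = k *\<^sub>c x + h" if "y \<in> ?s" for y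
      using that subspace by (metis cvec.span_breakdown_eq cvec.span_eq_iff add.commute diff_add_cancel)
    have z: "lie y z = 0" if yz: "y \<in> ?s" "z \<in> ?s" for y z
      using sp[OF yz(1)] sp[OF yz(2)]
      by (auto simp: lie_add_left lie_add_right lie_scaleC_left lie_scaleC_right lie_self x x' abelian)
    have "lie_subalgebra ?s" "lie_abelian ?s"
      using z by (simp_all add: lie_subalgebra_def lie_abelian_def cvec.span_zero)
    moreover have "\<tt> \<subseteq> ?s" using cvec.span_superset by blast
    ultimately have "?s = \<tt>" using cartan by (simp add: cartan_subalgebra_def)
    then show "x \<in> \<tt>" using cvec.span_superset by blast
  qed
qed

text \<open>The elements that act on a fixed vector by a scalar form a subspace, so diagonalizing a
  finite basis of \<open>\<tt>\<close> is enough. The scalars depend linearly on the element because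
  the vector is nonzero.\<close>

lemma span_weight_spaces: "cvec.span (\<Union>\<alpha>\<in>dual \<tt>. weight_space \<tt> \<alpha>) = UNIV"
proof -
  obtain F where F: "F \<subseteq> \<tt>" "cvec.independent F" "\<tt> \<subseteq> cvec.span F"
    by (rule cvec.maximal_independent_subset)
  have diag: "diagonalizable (lie h)" if "h \<in> F" for h
    using that F(1) cartan by (auto simp: cartan_subalgebra_def)
  have span: "cvec.span {x. \<forall>h\<in>F. \<exists>c. lie h x = c *\<^sub>c x} = UNIV"
    by (rule simultaneous_diagonalization)
      (use F diag independent_finite in \<open>auto intro: abelian\<close>)
  have "x \<in> (\<Union>\<alpha>\<in>dual \<tt>. weight_space \<tt> \<alpha>)" if x: "\<forall>h\<in>F. \<exists>c. lie h x = c *\<^sub>c x" for x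
  proof (cases "x = 0")
    case True
    then show ?thesis using dual_zero by (auto simp: weight_space_def)
  next
    case False
    have "cvec.span F \<subseteq> {h. \<exists>c. lie h x = c *\<^sub>c x}"
    proof (rule cvec.span_minimal)
      show "cvec.subspace {h. \<exists>c. lie h x = c *\<^sub>c x}"
        unfolding cvec.subspace_def
        by (auto simp: lie_add_left lie_scaleC_left cvec.scale_left_distrib[symmetric] intro: exI[of _ 0])
    qed (use x in auto)
    then have "\<forall>h. \<exists>c. h \<in> \<tt> \<longrightarrow> lie h x = c *\<^sub>c x" using F(3) by blast
    then obtain c where c: "lie h x = c h *\<^sub>c x" if "h \<in> \<tt>" for h by metis
    \<comment> \<open>\<open>c\<close> is unspecified off \<open>\<tt>\<close>, where members of
      \<open>dual \<tt>\<close> have to vanish.\<close>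
    define \<alpha> where "\<alpha> h = (if h \<in> \<tt> then c h else 0)" for h
    have "c (h + k) = c h + c k" if "h \<in> \<tt>" "k \<in> \<tt>" for h k
    proof (rule cvec.scale_right_imp_eq[OF False])
      have "c (h + k) *\<^sub>c x = lie (h + k) x"
        using that subspace by (simp only: c cvec.subspace_add)
      also have "\<dots> = (c h + c k) *\<^sub>c x"
        using that by (simp only: lie_add_left c cvec.scale_left_distrib)
      finally show "c (h + k) *\<^sub>c x = (c h + c k) *\<^sub>c x" .
    qed
    moreover have "c (r *\<^sub>c h) = r * c h" if "h \<in> \<tt>" for h r
    proof (rule cvec.scale_right_imp_eq[OF False])
      have "c (r *\<^sub>c h) *\<^sub>c x = lie (r *\<^sub>c h) x"
        using that subspace by (simp only: c cvec.subspace_scale)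
      also have "\<dots> = (r * c h) *\<^sub>c x"
        using that by (simp only: lie_scaleC_left c cvec.scale_scale)
      finally show "c (r *\<^sub>c h) *\<^sub>c x = (r * c h) *\<^sub>c x" .
    qed
    ultimately have "\<alpha> \<in> dual \<tt>"
      using subspace by (auto simp: dual_def \<alpha>_def cvec.subspace_add cvec.subspace_scale)
    moreover have "x \<in> weight_space \<tt> \<alpha>" by (simp add: weight_space_def c \<alpha>_def)
    ultimately show ?thesis by blast
  qed
  then have "{x. \<forall>h\<in>F. \<exists>c. lie h x = c *\<^sub>c x} \<subseteq> (\<Union>\<alpha>\<in>dual \<tt>. weight_space \<tt> \<alpha>)"
    by blast
  from cvec.span_mono[OF this] show ?thesis unfolding span by blast
qed

lemma weight_basis_exists:
  "\<exists>B wt. cvec.independent B \<and> cvec.span B = UNIV \<and>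
     (\<forall>b\<in>B. wt b \<in> dual \<tt> \<and> b \<in> weight_space \<tt> (wt b))"
proof -
  obtain B where B: "B \<subseteq> (\<Union>\<alpha>\<in>dual \<tt>. weight_space \<tt> \<alpha>)" "cvec.independent B"
      "(\<Union>\<alpha>\<in>dual \<tt>. weight_space \<tt> \<alpha>) \<subseteq> cvec.span B"
    by (rule cvec.maximal_independent_subset)
  have "cvec.span B = UNIV"
    using cvec.span_minimal[OF B(3)] span_weight_spaces by auto
  moreover have "\<forall>b\<in>B. \<exists>\<alpha>. \<alpha> \<in> dual \<tt> \<and> b \<in> weight_space \<tt> \<alpha>" using B(1) by blast
  then obtain wt where "\<forall>b\<in>B. wt b \<in> dual \<tt> \<and> b \<in> weight_space \<tt> (wt b)" by metis
  ultimately show ?thesis using B(2) by blast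
qed

end

section \<open>Traces over sums of weight spaces\<close>

text \<open>A basis with a weight label on each vector keeps track of multiplicities: a sum over
  \<open>B\<close> counts each weight as often as the dimension of its weight space, just as a trace
  does.\<close>

locale cartan_basis = cartan \<tt> for \<tt> :: "'a::fd_complex_lie_algebra set" +
  fixes B :: "'a set" and wt :: "'a \<Rightarrow> 'a \<Rightarrow> complex"
  assumes independent_B: "cvec.independent B" and span_B: "cvec.span B = UNIV"
    and wt_dual: "b \<in> B \<Longrightarrow> wt b \<in> dual \<tt>"
    and wt_space: "b \<in> B \<Longrightarrow> b \<in> weight_space \<tt> (wt b)"
begin

lemma finite_B: "finite B"
  by (rule independent_finite[OF independent_B])

lemma expansion: "(\<Sum>b\<in>B. cvec.representation B x b *\<^sub>c b) = x"
  using cvec.sum_representation_eq[OF independent_B _ finite_B order_refl] span_B by simp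

lemma representation_lie:
  assumes h: "h \<in> \<tt>" and b: "b \<in> B"
  shows "cvec.representation B (lie h x) b = wt b h * cvec.representation B x b"
proof -
  let ?r = "cvec.representation B"
  have "lie h x = (\<Sum>c\<in>B. ?r x c *\<^sub>c lie h c)"
    using clinear_sum_scale[OF lie_clinear, of h "?r x" "\<lambda>c. c" B] expansion[of x] by simp
  also have "\<dots> = (\<Sum>c\<in>B. (wt c h * ?r x c) *\<^sub>c c)"
    by (rule sum.cong) (simp_all add: weight_spaceD[OF wt_space h] mult.commute)
  finally have "?r (lie h x) b = (\<Sum>c\<in>B. (wt c h * ?r x c) * ?r c b)"
    by (simp add: representation_sum_scale[OF independent_B] span_B)
  also have "\<dots> = (\<Sum>c\<in>B. if c = b then wt b h * ?r x b else 0)"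
    by (rule sum.cong) (simp_all add: cvec.representation_basis[OF independent_B] )
  finally show ?thesis using b finite_B by simp
qed

lemma representation_weight:
  assumes x: "x \<in> weight_space \<tt> \<alpha>" and \<alpha>: "\<alpha> \<in> dual \<tt>" and r: "cvec.representation B x b \<noteq> 0"
  shows "b \<in> B \<and> wt b = \<alpha>"
proof -
  have b: "b \<in> B" using r by (rule cvec.representation_ne_zero)
  moreover have "wt b = \<alpha>"
  proof (rule dual_eqI[OF wt_dual[OF b] \<alpha>])
    fix h assume h: "h \<in> \<tt>"
    have "cvec.representation B (lie h x) b = \<alpha> h * cvec.representation B x b"
      by (simp add: weight_spaceD[OF x h] cvec.representation_scale[OF independent_B] span_B)
    then show "wt b h = \<alpha> h" using representation_lie[OF h b, of x] r by simp
  qed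
  ultimately show ?thesis by simp
qed

lemma weight_space_span:
  assumes x: "x \<in> weight_space \<tt> \<alpha>" and \<alpha>: "\<alpha> \<in> dual \<tt>"
  shows "x \<in> cvec.span {b\<in>B. wt b = \<alpha>}"
proof -
  let ?r = "cvec.representation B"
  have "?r x b *\<^sub>c b \<in> cvec.span {b\<in>B. wt b = \<alpha>}" if "b \<in> B" for b
    using representation_weight[OF x \<alpha>, of b]
    by (cases "?r x b = 0") (auto simp: cvec.span_zero intro: cvec.span_scale cvec.span_base)
  then have "(\<Sum>b\<in>B. ?r x b *\<^sub>c b) \<in> cvec.span {b\<in>B. wt b = \<alpha>}"
    by (intro cvec.span_sum)
  then show ?thesis by (simp add: expansion)
qed

lemma weight_exists:
  assumes "x \<in> weight_space \<tt> \<alpha>" "\<alpha> \<in> dual \<tt>" "x \<noteq> 0"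
  shows "\<exists>b\<in>B. wt b = \<alpha>"
proof (rule ccontr)
  assume "\<not> ?thesis"
  then have "{b\<in>B. wt b = \<alpha>} = {}" by blast
  then show False using weight_space_span[OF assms(1,2)] assms(3) by (simp only: cvec.span_empty) simp
qed

lemma basis_nonzero: "b \<in> B \<Longrightarrow> b \<noteq> 0"
  using independent_B cvec.dependent_zero by blast

lemma lie_mem:
  assumes "x \<in> weight_space \<tt> \<alpha>" "y \<in> weight_space \<tt> (- \<alpha>)"
  shows "lie x y \<in> \<tt>"
  using weight_space_lie[OF assms] by (simp add: self_centralizing)

text \<open>If the shifted weight does not occur at all, the bracket is zero. Hence \<open>J\<close>
  may end at a gap in the weights and still give a stable subspace, which is what half strings
  need.\<close>

lemma lie_basis_span:
  assumes x: "x \<in> weight_space \<tt> \<alpha>" and \<alpha>: "\<alpha> \<in> dual \<tt>" and b: "b \<in> B"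
    and J: "wt b + \<alpha> \<in> J \<or> wt b + \<alpha> \<notin> wt ` B"
  shows "lie x b \<in> cvec.span {b\<in>B. wt b \<in> J}"
proof -
  have m: "lie x b \<in> weight_space \<tt> (wt b + \<alpha>)"
    using weight_space_lie[OF x wt_space[OF b]] by (simp add: add.commute)
  have d: "wt b + \<alpha> \<in> dual \<tt>" by (rule dual_add[OF wt_dual[OF b] \<alpha>])
  show ?thesis
  proof (cases "wt b + \<alpha> \<in> J")
    case True
    then have "{c\<in>B. wt c = wt b + \<alpha>} \<subseteq> {b\<in>B. wt b \<in> J}" by auto
    then show ?thesis using weight_space_span[OF m d] cvec.span_mono by blast
  next
    case False
    then have "lie x b = 0" using J weight_exists[OF m d] by force
    then show ?thesis by (simp add: cvec.span_zero)
  qed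
qed

text \<open>The sum is the trace of \<open>ad [x, y]\<close> on the sum of the weight spaces with weight in \<open>J\<close>.\<close>

lemma trace_commutator:
  assumes x: "x \<in> weight_space \<tt> \<alpha>" and y: "y \<in> weight_space \<tt> (- \<alpha>)" and \<alpha>: "\<alpha> \<in> dual \<tt>"
    and J: "\<And>b. b \<in> B \<Longrightarrow> wt b \<in> J \<Longrightarrow> wt b + \<alpha> \<in> J \<or> wt b + \<alpha> \<notin> wt ` B"
      "\<And>b. b \<in> B \<Longrightarrow> wt b \<in> J \<Longrightarrow> wt b - \<alpha> \<in> J \<or> wt b - \<alpha> \<notin> wt ` B"
  shows "(\<Sum>b | b \<in> B \<and> wt b \<in> J. wt b (lie x y)) = 0"
proof -
  let ?C = "{b\<in>B. wt b \<in> J}" and ?h = "lie x y"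
  have h: "?h \<in> \<tt>" by (rule lie_mem[OF x y])
  have "(\<Sum>b\<in>?C. wt b ?h) = partial_trace B ?C (lie ?h)"
    unfolding partial_trace_def
    by (rule sum.cong) (simp_all add: representation_lie[OF h] cvec.representation_basis[OF independent_B])
  also have "\<dots> = partial_trace B ?C (\<lambda>z. lie x (lie y z)) - partial_trace B ?C (\<lambda>z. lie y (lie x z))"
    unfolding partial_trace_diff[OF independent_B span_B, symmetric] by (simp add: lie_lie[abs_def])
  also have "partial_trace B ?C (\<lambda>z. lie x (lie y z)) = partial_trace B ?C (\<lambda>z. lie y (lie x z))"
  proof (rule partial_trace_commute[OF independent_B _ _ lie_clinear _ lie_clinear])
    show "lie x b \<in> cvec.span ?C" if "b \<in> ?C" for b
      using lie_basis_span[OF x \<alpha>] J(1) that by blast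
    show "lie y b \<in> cvec.span ?C" if "b \<in> ?C" for b
      using lie_basis_span[OF y dual_minus[OF \<alpha>], of b J] J(2)[of b] that by simp
  qed (use finite_B in auto)
  finally show ?thesis by simp
qed

lemma killing_cartan:
  assumes "h \<in> \<tt>" "k \<in> \<tt>"
  shows "killing h k = (\<Sum>b\<in>B. wt b h * wt b k)"
  unfolding killing_basis[OF independent_B span_B] partial_trace_def
  by (rule sum.cong) (simp_all add: representation_lie assms cvec.representation_basis[OF independent_B])

lemma killing_orthogonal:
  assumes x: "x \<in> weight_space \<tt> \<alpha>" and y: "y \<in> weight_space \<tt> \<beta>"
    and h: "h \<in> \<tt>" "\<alpha> h + \<beta> h \<noteq> 0"
  shows "killing x y = 0"
proof -
  have "\<alpha> h * killing x y = killing (lie h x) y"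
    by (simp add: weight_spaceD[OF x h(1)] killing_scale_left)
  also have "\<dots> = - killing (lie x h) y"
    using killing_scale_left[of "-1" "lie x h" y] by (subst lie_anticomm) simp
  also have "\<dots> = - (\<beta> h * killing x y)"
    by (simp add: killing_invariant weight_spaceD[OF y h(1)] killing_scale_right)
  finally show ?thesis using h(2) by (simp add: eq_neg_iff_add_eq_0 distrib_right[symmetric])
qed

lemma killing_orthogonal':
  assumes "x \<in> weight_space \<tt> \<alpha>" "y \<in> weight_space \<tt> \<beta>" "\<alpha> \<in> dual \<tt>" "\<beta> \<in> dual \<tt>" "\<alpha> + \<beta> \<noteq> 0"
  shows "killing x y = 0"
proof -
  obtain h where "h \<in> \<tt>" "\<alpha> h + \<beta> h \<noteq> 0"
    using dual_eqI[OF dual_add[OF assms(3,4)] dual_zero] assms(5) by auto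
  then show ?thesis using killing_orthogonal assms(1,2) by blast
qed

text \<open>The trace of \<open>h = [x, y]\<close> on the \<open>\<alpha>\<close>-string through \<open>wt b\<close> vanishes, which is a linear relation
  with integer coefficients between \<open>wt b h\<close> and \<open>\<alpha> h\<close>.\<close>

lemma string_rational:
  assumes x: "x \<in> weight_space \<tt> \<alpha>" and y: "y \<in> weight_space \<tt> (- \<alpha>)" and \<alpha>: "\<alpha> \<in> dual \<tt>"
    and b: "b \<in> B"
  shows "\<exists>q. wt b (lie x y) = of_rat q * \<alpha> (lie x y)"
proof -
  let ?h = "lie x y"
  \<comment> \<open>Indexing by all integers makes the set of weights closed under adding and
    subtracting \<alpha>; only finitely many of them occur in \<open>B\<close>.\<close>
  define s where "s n = wt b + (\<lambda>z. of_int n * \<alpha> z)" for n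
  define C where "C = {c\<in>B. wt c \<in> range s}"
  have up: "s n + \<alpha> \<in> range s" and down: "s n - \<alpha> \<in> range s" for n
    by (rule range_eqI[of _ _ "n + 1"], simp add: s_def fun_eq_iff algebra_simps)
      (rule range_eqI[of _ _ "n - 1"], simp add: s_def fun_eq_iff algebra_simps)
  have "(\<Sum>c\<in>C. wt c ?h) = 0"
    unfolding C_def by (rule trace_commutator[OF x y \<alpha>]) (use up down in auto)
  moreover have "\<forall>c\<in>C. \<exists>n. wt c ?h = wt b ?h + of_int n * \<alpha> ?h"
    unfolding C_def s_def by auto
  then obtain n where n: "\<forall>c\<in>C. wt c ?h = wt b ?h + of_int (n c) * \<alpha> ?h" by metis
  ultimately have "of_nat (card C) * wt b ?h + (\<Sum>c\<in>C. of_int (n c)) * \<alpha> ?h = 0"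
    by (simp add: sum.distrib sum_distrib_right)
  then have "of_nat (card C) * wt b ?h = - of_int (\<Sum>c\<in>C. n c) * \<alpha> ?h"
    by (simp add: add_eq_0_iff)
  \<comment> \<open>\<open>b\<close> itself lies in \<open>C\<close>, so the relation can be divided
    by \<open>card C\<close>.\<close>
  moreover have "wt b \<in> range s" by (rule range_eqI[of _ _ 0]) (simp add: s_def fun_eq_iff)
  then have "card C \<noteq> 0" using b finite_B by (auto simp: C_def)
  ultimately have "wt b ?h = of_rat (- of_int (\<Sum>c\<in>C. n c) / of_nat (card C)) * \<alpha> ?h"
    by (simp add: of_rat_minus of_rat_divide of_rat_sum field_simps)
  then show ?thesis by blast
qed

lemma killing_string:
  assumes x: "x \<in> weight_space \<tt> \<alpha>" and y: "y \<in> weight_space \<tt> (- \<alpha>)" and \<alpha>: "\<alpha> \<in> dual \<tt>"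
    and nz: "\<alpha> (lie x y) \<noteq> 0"
  shows "\<exists>q>0. killing (lie x y) (lie x y) = of_rat q * (\<alpha> (lie x y))\<^sup>2"
proof -
  let ?h = "lie x y"
  have h: "?h \<in> \<tt>" by (rule lie_mem[OF x y])
  obtain q where q: "\<And>b. b \<in> B \<Longrightarrow> wt b ?h = of_rat (q b) * \<alpha> ?h"
    using string_rational[OF x y \<alpha>] by metis
  have "x \<noteq> 0" using nz dual_apply_zero[OF \<alpha>] by auto
  then obtain c where c: "c \<in> B" "wt c = \<alpha>" using weight_exists[OF x \<alpha>] by blast
  have "q c = 1" using q[OF c(1)] c(2) nz by simp
  then have "(\<Sum>b\<in>B. (q b)\<^sup>2) > 0"
    using c(1) finite_B by (intro sum_pos2[of _ c]) auto
  moreover have "killing ?h ?h = of_rat (\<Sum>b\<in>B. (q b)\<^sup>2) * (\<alpha> ?h)\<^sup>2"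
    unfolding killing_cartan[OF h h] of_rat_sum sum_distrib_right
    by (rule sum.cong) (simp_all add: q of_rat_power power2_eq_square algebra_simps of_rat_mult)
  ultimately show ?thesis by blast
qed

end

section \<open>Engel's theorem for graded subalgebras and nondegeneracy of the Killing form\<close>

context cartan_basis
begin

section \<open>Homogeneous components\<close>

definition component :: "('a \<Rightarrow> complex) \<Rightarrow> 'a \<Rightarrow> 'a" where
  "component \<alpha> x = (\<Sum>b | b \<in> B \<and> wt b = \<alpha>. cvec.representation B x b *\<^sub>c b)"

lemma component_add: "component \<alpha> (x + y) = component \<alpha> x + component \<alpha> y"
  by (simp add: component_def cvec.representation_add[OF independent_B] span_B
      cvec.scale_left_distrib sum.distrib)

lemma component_scale: "component \<alpha> (c *\<^sub>c x) = c *\<^sub>c component \<alpha> x"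
  by (simp add: component_def cvec.representation_scale[OF independent_B] span_B cvec.scale_sum_right)

lemma component_sum: "component \<alpha> (\<Sum>i\<in>I. f i) = (\<Sum>i\<in>I. component \<alpha> (f i))"
proof -
  have "component \<alpha> 0 = 0" using component_scale[of \<alpha> 0 0] by simp
  then show ?thesis
    by (induction I rule: infinite_finite_induct) (simp_all add: component_add)
qed

lemma component_mem: "component \<alpha> x \<in> weight_space \<tt> \<alpha>"
  unfolding component_def
  by (intro cvec.subspace_sum[OF weight_space_subspace] cvec.subspace_scale[OF weight_space_subspace])
    (use wt_space in auto)

lemma component_weight:
  assumes x: "x \<in> weight_space \<tt> \<alpha>" and \<alpha>: "\<alpha> \<in> dual \<tt>"
  shows "component \<beta> x = (if \<beta> = \<alpha> then x else 0)"
proof -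
  let ?r = "cvec.representation B"
  have "component \<beta> x = (\<Sum>b\<in>B. if wt b = \<beta> then ?r x b *\<^sub>c b else 0)"
    unfolding component_def by (simp add: sum.inter_filter[OF finite_B])
  also have "\<dots> = (\<Sum>b\<in>B. if \<beta> = \<alpha> then ?r x b *\<^sub>c b else 0)"
    by (rule sum.cong) (use representation_weight[OF x \<alpha>] in fastforce)+
  finally show ?thesis by (simp add: expansion)
qed

lemma sum_components: "(\<Sum>\<alpha>\<in>wt ` B. component \<alpha> x) = x"
proof -
  have "(\<Sum>\<alpha>\<in>wt ` B. component \<alpha> x) = (\<Sum>b\<in>B. cvec.representation B x b *\<^sub>c b)"
    unfolding component_def by (rule sum.group) (use finite_B in auto)
  then show ?thesis by (simp add: expansion)
qed

lemma component_lie: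
  assumes w: "w \<in> weight_space \<tt> \<beta>" and \<beta>: "\<beta> \<in> dual \<tt>"
  shows "component (\<alpha> + \<beta>) (lie w x) = lie w (component \<alpha> x)"
proof -
  have *: "component (\<alpha> + \<beta>) (lie w (component \<gamma> x)) = (if \<gamma> = \<alpha> then lie w (component \<alpha> x) else 0)"
    if "\<gamma> \<in> wt ` B" for \<gamma>
  proof -
    have "\<gamma> \<in> dual \<tt>" using that wt_dual by blast
    then show ?thesis
      using component_weight[OF weight_space_lie[OF w component_mem] dual_add[OF \<beta>], of \<gamma> "\<alpha> + \<beta>" x]
      by (simp add: add.commute)
  qed
  have "component (\<alpha> + \<beta>) (lie w x) = (\<Sum>\<gamma>\<in>wt ` B. component (\<alpha> + \<beta>) (lie w (component \<gamma> x)))"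
    by (subst sum_components[of x, symmetric]) (simp only: lie_sum_right component_sum)
  also have "\<dots> = (\<Sum>\<gamma>\<in>wt ` B. if \<gamma> = \<alpha> then lie w (component \<alpha> x) else 0)"
    by (rule sum.cong) (simp_all add: *)
  also have "\<dots> = lie w (component \<alpha> x)"
  proof (cases "\<alpha> \<in> wt ` B")
    case False
    then have "component \<alpha> x = 0" unfolding component_def by (intro sum.neutral) auto
    then show ?thesis by (simp cong: if_cong)
  qed (use finite_B in \<open>simp add: sum.delta'\<close>)
  finally show ?thesis .
qed

text \<open>The iterates of a basis vector have the weights \<open>wt b\<close> + n \<alpha>, which
  are pairwise distinct as \<alpha> is nonzero, so one of them is not among the finitely many
  weights. Vectors killed by some power form a subspace, hence the exponent may depend on the
  vector.\<close>

lemma lie_locally_nilpotent: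
  assumes x: "x \<in> weight_space \<tt> \<alpha>" and \<alpha>: "\<alpha> \<in> dual \<tt>" "\<alpha> \<noteq> 0"
  shows "\<exists>n. (lie x ^^ n) v = 0"
proof -
  let ?V = "{v. \<exists>n. (lie x ^^ n) v = 0}"
  have z: "(lie x ^^ n) 0 = 0" for n by (induction n) simp_all
  have add: "(lie x ^^ n) (u + v) = (lie x ^^ n) u + (lie x ^^ n) v" for n u v
    by (induction n) (simp_all add: lie_add_right)
  have scale: "(lie x ^^ n) (c *\<^sub>c v) = c *\<^sub>c (lie x ^^ n) v" for n c v
    by (induction n) (simp_all add: lie_scaleC_right)
  have sub: "cvec.subspace ?V"
    unfolding cvec.subspace_def
  proof (intro conjI ballI allI)
    show "0 \<in> ?V" using z by blast
  next
    fix u v assume "u \<in> ?V" "v \<in> ?V"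
    then obtain m n where mn: "(lie x ^^ m) u = 0" "(lie x ^^ n) v = 0" by blast
    have "(lie x ^^ (n + m)) u = 0" "(lie x ^^ (m + n)) v = 0"
      by (simp_all only: funpow_add comp_apply mn z)
    then have "(lie x ^^ (m + n)) (u + v) = 0" by (simp add: add add.commute)
    then show "u + v \<in> ?V" by blast
  qed (use scale in auto)
  have "b \<in> ?V" if b: "b \<in> B" for b
  proof -
    define s where "s n = wt b + (\<lambda>z. of_nat n * \<alpha> z)" for n
    have "inj s"
    proof (rule injI)
      fix m n assume "s m = s n"
      moreover obtain h where "\<alpha> h \<noteq> 0" using \<alpha>(2) by (auto simp: fun_eq_iff)
      ultimately show "m = n" by (auto simp: s_def fun_eq_iff)
    qed
    then have "infinite (range s)" using finite_imageD[of s UNIV] by auto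
    then obtain n where n: "s n \<notin> wt ` B"
      using finite_B by (meson finite_imageI finite_subset image_subsetI rangeE subsetI)
    have "s n \<in> dual \<tt>" by (simp add: s_def dual_add dual_scale \<alpha> wt_dual b)
    moreover have "(lie x ^^ k) b \<in> weight_space \<tt> (s k)" for k
    proof (induction k)
      case 0
      then show ?case using wt_space[OF b] by (simp add: s_def plus_fun_def)
    next
      case (Suc k)
      have "\<alpha> + s k = s (Suc k)" by (simp add: s_def fun_eq_iff algebra_simps)
      then show ?case using weight_space_lie[OF x Suc] by simp
    qed
    ultimately have "(lie x ^^ n) b = 0"
      using weight_exists[of "(lie x ^^ n) b" "s n"] n by (metis image_eqI)
    then show ?thesis by blast
  qed
  then have "cvec.span B \<subseteq> ?V" by (intro cvec.span_minimal[OF _ sub]) blast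
  then show ?thesis by (auto simp: span_B)
qed

text \<open>Stated for pairs \<open>U \<subset> M\<close> of stable subspaces, to avoid the quotient module \<open>M/U\<close>.\<close>

definition engel :: "'a set \<Rightarrow> bool" where
  "engel W \<longleftrightarrow> (\<forall>U M. cvec.subspace U \<longrightarrow> cvec.subspace M \<longrightarrow> U \<subset> M \<longrightarrow>
     (\<forall>w\<in>W. (\<forall>u\<in>U. lie w u \<in> U) \<and> (\<forall>u\<in>M. lie w u \<in> M)) \<longrightarrow>
     (\<exists>x\<in>M - U. \<forall>w\<in>W. lie w x \<in> U))"

lemma span_insert_subspaceE:
  assumes "cvec.subspace W" "y \<in> cvec.span (insert z W)"
  obtains w k where "w \<in> W" "y = w + k *\<^sub>c z"
proof -
  obtain k where "y - k *\<^sub>c z \<in> cvec.span W" using assms(2) unfolding cvec.span_breakdown_eq by blast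
  then show thesis using that[of "y - k *\<^sub>c z" k] assms(1) by (simp add: cvec.span_eq_iff[THEN iffD2])
qed

text \<open>The vectors of \<open>M\<close> that \<open>W\<close> sends into \<open>U\<close> form a
  space stable under \<open>z\<close>, because \<open>z\<close> normalizes \<open>W\<close>.
  Starting from such a vector outside \<open>U\<close>, the last iterate of \<open>z\<close> that is
  still outside \<open>U\<close> is sent into \<open>U\<close> by \<open>W\<close> and by
  \<open>z\<close>.\<close>

lemma engel_insert:
  assumes W: "cvec.subspace W" "engel W"
    and z: "\<And>v. \<exists>n. (lie z ^^ n) v = 0" "\<And>w. w \<in> W \<Longrightarrow> lie w z \<in> W"
  shows "engel (cvec.span (insert z W))"
  unfolding engel_def
proof (intro allI impI)
  fix U M
  assume UM: "cvec.subspace U" "cvec.subspace M" "U \<subset> M"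
    and st: "\<forall>w\<in>cvec.span (insert z W). (\<forall>u\<in>U. lie w u \<in> U) \<and> (\<forall>u\<in>M. lie w u \<in> M)"
  have st': "\<forall>w\<in>W. (\<forall>u\<in>U. lie w u \<in> U) \<and> (\<forall>u\<in>M. lie w u \<in> M)"
    and stz: "\<And>u. u \<in> U \<Longrightarrow> lie z u \<in> U" "\<And>u. u \<in> M \<Longrightarrow> lie z u \<in> M"
    using st by (auto simp: cvec.span_base)
  define M' where "M' = {x\<in>M. \<forall>w\<in>W. lie w x \<in> U}"
  have M'z: "lie z x \<in> M'" if "x \<in> M'" for x
  proof -
    have "lie w (lie z x) \<in> U" if w: "w \<in> W" for w
      unfolding lie_derivation[of w z x]
      using \<open>x \<in> M'\<close> w z(2)[OF w] by (intro cvec.subspace_add[OF UM(1)] stz) (auto simp: M'_def)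
    then show ?thesis using that stz by (auto simp: M'_def)
  qed
  obtain x where x: "x \<in> M" "x \<notin> U" "\<forall>w\<in>W. lie w x \<in> U"
    using W(2)[unfolded engel_def, rule_format, of U M] UM st' by blast
  have it: "(lie z ^^ n) x \<in> M'" for n
    by (induction n) (use x M'z in \<open>auto simp: M'_def\<close>)
  have ex: "\<exists>n. (lie z ^^ n) x \<in> U" using z(1)[of x] cvec.subspace_0[OF UM(1)] by metis
  \<comment> \<open>The least exponent is positive because \<open>x\<close> is not in
    \<open>U\<close>, so there is a previous iterate, and that one is outside
    \<open>U\<close>.\<close>
  define n where "n = (LEAST n. (lie z ^^ n) x \<in> U)"
  have n: "(lie z ^^ n) x \<in> U" unfolding n_def by (rule LeastI_ex[OF ex])
  then obtain m where m: "n = Suc m" using x(2) by (cases n) auto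
  have "(lie z ^^ m) x \<notin> U"
    using not_less_Least[of m "\<lambda>n. (lie z ^^ n) x \<in> U"] m by (simp add: n_def)
  moreover have "lie w ((lie z ^^ m) x) \<in> U" if wW: "w \<in> cvec.span (insert z W)" for w
  proof -
    obtain v k where w: "v \<in> W" "w = v + k *\<^sub>c z" using W(1) wW by (rule span_insert_subspaceE)
    have "lie v ((lie z ^^ m) x) \<in> U" using it[of m] w(1) by (simp add: M'_def)
    moreover have "lie z ((lie z ^^ m) x) \<in> U" using n m by simp
    ultimately show ?thesis
      by (simp add: w lie_add_left lie_scaleC_left cvec.subspace_add[OF UM(1)] cvec.subspace_scale[OF UM(1)])
  qed
  ultimately show "\<exists>x\<in>M - U. \<forall>w\<in>cvec.span (insert z W). lie w x \<in> U"
    using it[of m] by (intro bexI[of _ "(lie z ^^ m) x"]) (auto simp: M'_def)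
qed

definition graded :: "'a set \<Rightarrow> bool" where
  "graded W \<longleftrightarrow> (\<forall>x\<in>W. \<forall>\<alpha>. component \<alpha> x \<in> W)"

text \<open>Ad-nilpotency is known only for homogeneous elements of nonzero weight, so the usual
  induction must stay within graded subalgebras. For one of maximal dimension among those with the
  property, \<open>engel\<close> applied to the pair \<open>W\<close>, \<open>N\<close> gives a
  normalizing element outside \<open>W\<close>. One of its homogeneous components is outside
  \<open>W\<close> as well and still normalizes it; by the hypothesis on \<open>component 0\<close>
  its weight is nonzero, and \<open>engel_insert\<close> enlarges \<open>W\<close>.\<close>

theorem engel_graded:
  assumes N: "lie_subalgebra N" "graded N" and N0: "\<And>x. x \<in> N \<Longrightarrow> component 0 x = 0"
  shows "engel N"
proof -
  interpret fd: finite_dimensional_vector_space "(*\<^sub>c) :: complex \<Rightarrow> 'a \<Rightarrow> 'a" B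
    by unfold_locales (simp_all add: finite_B independent_B span_B)
  define P where "P W \<longleftrightarrow> lie_subalgebra W \<and> graded W \<and> W \<subseteq> N \<and> engel W" for W
  have subN: "cvec.subspace N" using N(1) by (simp add: lie_subalgebra_def)
  have "P {0}"
    using subN component_scale[of _ 0 0]
    by (auto simp: P_def lie_subalgebra_def graded_def engel_def cvec.subspace_0)
  moreover have "\<forall>W. P W \<longrightarrow> cvec.dim W < Suc fd.dimension"
    using fd.dim_subset_UNIV by (simp add: less_Suc_eq_le)
  ultimately have "\<exists>W. P W \<and> (\<forall>W'. P W' \<longrightarrow> cvec.dim W' \<le> cvec.dim W)"
    by (rule Lattices_Big.ex_has_greatest_nat)
  then obtain W where W: "P W" and max: "\<And>W'. P W' \<Longrightarrow> cvec.dim W' \<le> cvec.dim W" by blast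
  have sW: "cvec.subspace W" and cW: "\<And>v w. v \<in> W \<Longrightarrow> w \<in> W \<Longrightarrow> lie v w \<in> W"
    and gW: "\<And>w \<alpha>. w \<in> W \<Longrightarrow> component \<alpha> w \<in> W" and WN: "W \<subseteq> N" and eW: "engel W"
    using W by (auto simp: P_def lie_subalgebra_def graded_def)
  have "W = N"
  proof (rule ccontr)
    assume "W \<noteq> N"
    then have "W \<subset> N" using WN by blast
    then have "\<exists>x\<in>N - W. \<forall>w\<in>W. lie w x \<in> W"
      using cW WN N(1)
      by (intro eW[unfolded engel_def, rule_format] sW subN) (auto simp: lie_subalgebra_def)
    then obtain x where x: "x \<in> N" "x \<notin> W" "\<And>w. w \<in> W \<Longrightarrow> lie w x \<in> W" by blast
    have "\<exists>\<alpha>\<in>wt ` B. component \<alpha> x \<notin> W"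
      using sum_components[of x] x(2) cvec.subspace_sum[OF sW, of "wt ` B" "\<lambda>\<alpha>. component \<alpha> x"] by auto
    then obtain \<alpha> where \<alpha>: "\<alpha> \<in> dual \<tt>" and zW: "component \<alpha> x \<notin> W" using wt_dual by blast
    define z where "z = component \<alpha> x"
    have "\<alpha> \<noteq> 0" using zW N0[OF x(1)] cvec.subspace_0[OF sW] by auto
    then have nil: "\<exists>n. (lie z ^^ n) v = 0" for v
      using lie_locally_nilpotent[OF component_mem \<alpha>] z_def by blast
    \<comment> \<open>The bracket of a component of \<open>w\<close> with \<open>z\<close> is a
      component of the bracket with \<open>x\<close>, which lies in \<open>W\<close>; gradedness of
      \<open>W\<close> is used both for \<open>w\<close> and for this bracket.\<close>
    have wz: "lie w z \<in> W" if w: "w \<in> W" for w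
    proof -
      have "lie (component \<beta> w) z \<in> W" if "\<beta> \<in> wt ` B" for \<beta>
      proof -
        have "\<beta> \<in> dual \<tt>" using that wt_dual by blast
        then have "lie (component \<beta> w) z = component (\<alpha> + \<beta>) (lie (component \<beta> w) x)"
          by (simp add: component_lie[OF component_mem] z_def)
        then show ?thesis using gW[OF x(3)[OF gW[OF w]]] by simp
      qed
      then have "(\<Sum>\<beta>\<in>wt ` B. lie z (component \<beta> w)) \<in> W"
        using cvec.subspace_neg[OF sW] by (intro cvec.subspace_sum[OF sW]) (simp add: lie_anticomm[of z])
      then have "lie z w \<in> W" using sum_components[of w] by (simp add: lie_sum_right[symmetric])
      then show ?thesis using cvec.subspace_neg[OF sW] by (simp add: lie_anticomm[of w])
    qed
    let ?W = "cvec.span (insert z W)"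
    have zN: "z \<in> N" using N(2) x(1) by (simp add: graded_def z_def)
    have "P ?W"
      unfolding P_def
    proof (intro conjI)
      have lie_mem: "lie u v \<in> ?W" if "u \<in> ?W" "v \<in> ?W" for u v
      proof -
        obtain u' k where u: "u' \<in> W" "u = u' + k *\<^sub>c z" using sW \<open>u \<in> ?W\<close> by (rule span_insert_subspaceE)
        obtain v' l where v: "v' \<in> W" "v = v' + l *\<^sub>c z" using sW \<open>v \<in> ?W\<close> by (rule span_insert_subspaceE)
        have "lie z v' \<in> W" using wz[OF v(1)] cvec.subspace_neg[OF sW] by (simp add: lie_anticomm[of z])
        then have "lie u v \<in> W"
          using cW[OF u(1) v(1)] wz[OF u(1)]
          by (simp add: u v lie_add_left lie_add_right lie_scaleC_left lie_scaleC_right lie_self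
              cvec.subspace_add[OF sW] cvec.subspace_scale[OF sW])
        then show ?thesis by (simp add: cvec.span_base)
      qed
      then show "lie_subalgebra ?W" by (simp add: lie_subalgebra_def)
      show "graded ?W"
        unfolding graded_def
      proof (intro ballI allI)
        fix u \<gamma> assume "u \<in> ?W"
        with sW obtain u' k where u: "u' \<in> W" "u = u' + k *\<^sub>c z" by (rule span_insert_subspaceE)
        have "component \<gamma> z \<in> ?W"
          using component_weight[OF component_mem \<alpha>, of \<gamma> x] by (simp add: z_def[symmetric] cvec.span_zero cvec.span_base)
        then show "component \<gamma> u \<in> ?W"
          using gW[OF u(1)] by (simp add: u component_add component_scale cvec.span_add cvec.span_scale cvec.span_base)
      qed
      show "?W \<subseteq> N" by (rule cvec.span_minimal) (use WN zN subN in auto)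
      show "engel ?W" by (rule engel_insert[OF sW eW nil wz])
    qed
    then have "cvec.dim ?W \<le> cvec.dim W" by (rule max)
    moreover have "cvec.span W \<subset> cvec.span ?W"
    proof -
      have "W \<subseteq> ?W" "z \<in> ?W" using cvec.span_superset by blast+
      then show ?thesis using zW sW by (auto simp: cvec.span_eq_iff[THEN iffD2] z_def)
    qed
    then have "cvec.dim W < cvec.dim ?W" by (rule fd.dim_psubset)
    ultimately show False by simp
  qed
  then show ?thesis using eW by simp
qed

end

section \<open>Semisimplicity and the radical of the Killing form\<close>

locale semisimple_cartan = cartan_basis \<tt> B wt
  for \<tt> :: "'a::fd_complex_lie_algebra set" and B :: "'a set" and wt +
  assumes semisimple: "semisimple_lie TYPE('a)"
begin

lemma abelian_ideal_trivial:
  assumes "lie_ideal R (UNIV :: 'a set)" "lie_abelian R"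
  shows "R = {0}"
proof -
  have "{lie x y |x y. x \<in> R \<and> y \<in> R} \<subseteq> {0}" using assms(2) by (auto simp: lie_abelian_def)
  then have "lie_product R R \<subseteq> cvec.span {0}" unfolding lie_product_def by (rule cvec.span_mono)
  then have "lie_product R R \<subseteq> {0}" by simp
  moreover have "0 \<in> lie_product R R" unfolding lie_product_def by (rule cvec.span_zero)
  ultimately have "lie_product R R = {0}" by blast
  then have "derived_series R (Suc 0) = {0}" by simp
  then show ?thesis using assms(1) semisimple unfolding semisimple_lie_def lie_solvable_def by blast
qed

lemma center_trivial:
  assumes "\<And>y. lie x y = 0"
  shows "x = (0::'a)"
proof -
  have "{x::'a. \<forall>y. lie x y = 0} = {0}"
  proof (rule abelian_ideal_trivial)
    show "lie_ideal {x::'a. \<forall>y. lie x y = 0} UNIV"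
      unfolding lie_ideal_def cvec.subspace_def
      by (auto simp: lie_add_left lie_scaleC_left lie_lie)
  qed (simp add: lie_abelian_def)
  then show ?thesis using assms by blast
qed

text \<open>Such an element acts as zero on a weight basis, so it is central, and the center is an
  abelian ideal.\<close>

lemma weights_separate:
  assumes h: "h \<in> \<tt>" and w: "\<And>b. b \<in> B \<Longrightarrow> wt b h = 0"
  shows "h = 0"
proof (rule center_trivial)
  fix y
  have "(\<Sum>b\<in>B. cvec.representation B (lie h y) b *\<^sub>c b) = 0"
    by (rule sum.neutral) (simp add: representation_lie h w)
  then show "lie h y = 0" by (simp add: expansion)
qed

text \<open>A nonzero \<alpha> h at h = [x, y] would make the Killing form at h nonzero by
  \<open>killing_string\<close>. So \<alpha> h = 0 in either case, and then all weights, being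
  multiples of \<alpha> at h, vanish there too.\<close>

lemma commutator_isotropic:
  assumes x: "x \<in> weight_space \<tt> \<alpha>" and y: "y \<in> weight_space \<tt> (- \<alpha>)" and \<alpha>: "\<alpha> \<in> dual \<tt>"
    and k: "killing (lie x y) (lie x y) = 0 \<or> \<alpha> (lie x y) = 0"
  shows "lie x y = 0"
proof (rule weights_separate[OF lie_mem[OF x y]])
  have "\<alpha> (lie x y) = 0"
  proof (rule ccontr)
    assume nz: "\<alpha> (lie x y) \<noteq> 0"
    with killing_string[OF x y \<alpha>] obtain q :: rat where "q > 0"
      "killing (lie x y) (lie x y) = of_rat q * (\<alpha> (lie x y))\<^sup>2" by blast
    then show False using k nz by simp
  qed
  then show "wt b (lie x y) = 0" if "b \<in> B" for b
    using string_rational[OF x y \<alpha> that] by auto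
qed

text \<open>The elements of nonzero weight in the radical of the Killing form span an ideal without zero
  weight, since an element \<open>h = [x, y]\<close> of \<open>\<tt>\<close> in the radical is isotropic. By Engel's theorem this ideal
  has a nonzero center unless it vanishes, and its center is an abelian ideal of the whole algebra.\<close>

theorem killing_radical_weight:
  assumes "x \<in> weight_space \<tt> \<alpha>" "\<alpha> \<in> dual \<tt>" "\<alpha> \<noteq> 0" "\<And>y. killing x y = 0"
  shows "x = 0"
proof -
  define S where "S = {x. \<exists>\<alpha>\<in>dual \<tt>. \<alpha> \<noteq> 0 \<and> x \<in> weight_space \<tt> \<alpha> \<and> (\<forall>y. killing x y = 0)}"
  define N where "N = cvec.span S"
  have subN: "cvec.subspace N" by (simp add: N_def)
  have N_basis: "lie b x \<in> N" if x: "x \<in> S" and b: "b \<in> B" for x b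
  proof -
    obtain \<alpha> where \<alpha>: "\<alpha> \<in> dual \<tt>" "\<alpha> \<noteq> 0" "x \<in> weight_space \<tt> \<alpha>" and k: "\<And>y. killing x y = 0"
      using x by (auto simp: S_def)
    note \<beta> = wt_dual[OF b] wt_space[OF b]
    have k': "killing (lie b x) y = 0" for y
      using killing_invariant[of b x y] killing_commute[of b "lie x y"] killing_invariant[of x y b] k
      by simp
    show ?thesis
    proof (cases "wt b + \<alpha> = 0")
      case True
      then have "- wt b = \<alpha>" by (simp add: minus_unique)
      then have "lie b x = 0"
        using commutator_isotropic[of b "wt b" x] \<alpha> \<beta> k' by simp
      then show ?thesis using cvec.subspace_0[OF subN] by simp
    next
      case False
      then have "lie b x \<in> S"
        using weight_space_lie[OF \<beta>(2) \<alpha>(3)] dual_add[OF \<beta>(1) \<alpha>(1)] k' by (auto simp: S_def)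
      then show ?thesis by (simp add: N_def cvec.span_base)
    qed
  qed
  have N_gen: "lie y x \<in> N" if x: "x \<in> S" for x y
  proof -
    have "lie x b \<in> N" if "b \<in> B" for b
      using N_basis[OF x that] cvec.subspace_neg[OF subN] by (simp add: lie_anticomm[of x])
    then have "(\<Sum>b\<in>B. cvec.representation B y b *\<^sub>c lie x b) \<in> N"
      by (intro cvec.subspace_sum[OF subN] cvec.subspace_scale[OF subN])
    moreover have "(\<Sum>b\<in>B. cvec.representation B y b *\<^sub>c lie x b) = lie x y"
      using clinear_sum_scale[OF lie_clinear, of x "cvec.representation B y" "\<lambda>b. b" B] expansion[of y]
      by simp
    ultimately show ?thesis using cvec.subspace_neg[OF subN] by (simp add: lie_anticomm[of y])
  qed
  have N_ideal: "lie y x \<in> N" if x: "x \<in> N" for x y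
  proof -
    have "cvec.subspace {x. lie y x \<in> N}"
      using subN unfolding cvec.subspace_def by (auto simp: lie_add_right lie_scaleC_right)
    then have "N \<subseteq> {x. lie y x \<in> N}"
      using N_gen unfolding N_def by (intro cvec.span_minimal) auto
    then show ?thesis using x by blast
  qed
  have comp: "component \<beta> x \<in> N \<and> component 0 x = 0" if x: "x \<in> N" for x \<beta>
  proof -
    have "cvec.subspace {x. component \<beta> x \<in> N \<and> component 0 x = 0}"
      using subN component_scale[of _ 0 0] unfolding cvec.subspace_def
      by (auto simp: component_add component_scale)
    moreover have "component \<beta> x \<in> N \<and> component 0 x = 0" if x: "x \<in> S" for x
    proof -
      obtain \<alpha> where \<alpha>: "\<alpha> \<in> dual \<tt>" "\<alpha> \<noteq> 0" "x \<in> weight_space \<tt> \<alpha>" using x by (auto simp: S_def)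
      have "x \<in> N" using x by (simp add: N_def cvec.span_base)
      then show ?thesis
        using component_weight[OF \<alpha>(3,1)] \<alpha>(2) cvec.subspace_0[OF subN] by auto
    qed
    ultimately have "N \<subseteq> {x. component \<beta> x \<in> N \<and> component 0 x = 0}"
      unfolding N_def by (intro cvec.span_minimal) (auto simp: N_def)
    then show ?thesis using x by blast
  qed
  have "engel N"
    by (rule engel_graded) (use subN N_ideal comp in \<open>auto simp: lie_subalgebra_def graded_def\<close>)
  define Z where "Z = {x\<in>N. \<forall>w\<in>N. lie w x = 0}"
  have "Z = {0}"
  proof (rule abelian_ideal_trivial)
    have "lie w (lie y x) = 0" if "x \<in> Z" "w \<in> N" for w x y
    proof -
      have "lie w y \<in> N"
        using N_ideal[OF that(2), of y] cvec.subspace_neg[OF subN] by (simp add: lie_anticomm[of w])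
      then show ?thesis using that by (simp add: lie_derivation[of w] Z_def)
    qed
    moreover have "cvec.subspace Z"
      using subN unfolding Z_def cvec.subspace_def by (auto simp: lie_add_right lie_scaleC_right)
    ultimately show "lie_ideal Z UNIV" using N_ideal by (auto simp: lie_ideal_def Z_def)
    show "lie_abelian Z" by (auto simp: lie_abelian_def Z_def)
  qed
  have "N = {0}"
  proof (rule ccontr)
    assume "N \<noteq> {0}"
    then have "{0} \<subset> N" using cvec.subspace_0[OF subN] by blast
    then have "\<exists>x\<in>N - {0}. \<forall>w\<in>N. lie w x \<in> {0}"
      by (intro \<open>engel N\<close>[unfolded engel_def, rule_format] subN) (auto simp: N_ideal)
    then show False using \<open>Z = {0}\<close> by (auto simp: Z_def)
  qed
  moreover have "x \<in> N" using assms by (auto simp: N_def S_def intro!: cvec.span_base)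
  ultimately show ?thesis by blast
qed

lemma killing_commutator:
  assumes x: "x \<in> weight_space \<tt> \<alpha>" and h: "h \<in> \<tt>"
  shows "killing h (lie x y) = \<alpha> h * killing x y"
  unfolding killing_invariant[symmetric] weight_spaceD[OF x h] by (rule killing_scale_left)

text \<open>If \<open>x\<close> commuted with the whole weight space of - \<alpha>, it would be in
  the radical of the Killing form: it is orthogonal to the other weight spaces anyway, and to this
  one by \<open>killing_commutator\<close>. This contradicts \<open>killing_radical_weight\<close>.
  A nonzero commutator has \<alpha> nonzero on it by \<open>commutator_isotropic\<close>.\<close>

lemma root_commutator_nonzero:
  assumes \<alpha>: "\<alpha> \<in> roots \<tt> UNIV"
  shows "\<exists>x y. x \<in> weight_space \<tt> \<alpha> \<and> y \<in> weight_space \<tt> (- \<alpha>) \<and> \<alpha> (lie x y) \<noteq> 0"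
proof -
  have d: "\<alpha> \<in> dual \<tt>" "\<alpha> \<noteq> 0" using \<alpha> by (auto simp: roots_def)
  obtain x where x: "x \<in> weight_space \<tt> \<alpha>" "x \<noteq> 0"
    using \<alpha> by (auto simp: roots_def weight_space_def)
  obtain h where h: "h \<in> \<tt>" "\<alpha> h \<noteq> 0" using dual_eqI[OF d(1) dual_zero] d(2) by auto
  have "\<exists>y\<in>weight_space \<tt> (- \<alpha>). lie x y \<noteq> 0"
  proof (rule ccontr)
    assume "\<not> ?thesis"
    then have c: "lie x y = 0" if "y \<in> weight_space \<tt> (- \<alpha>)" for y using that by blast
    have k: "killing x b = 0" if b: "b \<in> B" for b
    proof (cases "\<alpha> + wt b = 0")
      case True
      then have "wt b = - \<alpha>" by (simp add: minus_unique)
      then have "killing h (lie x b) = 0" using c wt_space[OF b] by simp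
      then show ?thesis using killing_commutator[OF x(1) h(1)] h(2) by simp
    next
      case False
      then show ?thesis using killing_orthogonal'[OF x(1) wt_space[OF b] d(1) wt_dual[OF b]] by blast
    qed
    have "cvec.subspace {y. killing x y = 0}"
      by (auto simp: cvec.subspace_def killing_add_right killing_scale_right)
    then have "cvec.span B \<subseteq> {y. killing x y = 0}" by (intro cvec.span_minimal) (use k in auto)
    then have "killing x y = 0" for y by (auto simp: span_B)
    then show False using killing_radical_weight[OF x(1) d] x(2) by blast
  qed
  then obtain y where "y \<in> weight_space \<tt> (- \<alpha>)" "lie x y \<noteq> 0" by blast
  then show ?thesis using commutator_isotropic[OF x(1) _ d(1)] x(1) by blast
qed

end

section \<open>The form on the roots\<close>

lemma sum_mset_fun_apply: "(\<Sum>\<^sub># M) x = (\<Sum>f\<in>#M. f x)"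
  for M :: "('a \<Rightarrow> 'b::comm_monoid_add) multiset"
  by (induction M) simp_all

lemma complex_of_rat_conv: "of_rat q = complex_of_real (of_rat q)"
  by (cases q) (simp add: of_rat_rat)

context semisimple_cartan
begin

lemma roots_iff: "\<alpha> \<in> roots \<tt> UNIV \<longleftrightarrow> \<alpha> \<noteq> 0 \<and> \<alpha> \<in> wt ` B"
proof
  assume "\<alpha> \<in> roots \<tt> UNIV"
  then obtain x where "\<alpha> \<noteq> 0" "\<alpha> \<in> dual \<tt>" "x \<in> weight_space \<tt> \<alpha>" "x \<noteq> 0"
    by (auto simp: roots_def weight_space_def)
  then show "\<alpha> \<noteq> 0 \<and> \<alpha> \<in> wt ` B" using weight_exists[of x \<alpha>] by (metis image_eqI)
next
  assume "\<alpha> \<noteq> 0 \<and> \<alpha> \<in> wt ` B"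
  then obtain b where "\<alpha> \<noteq> 0" "\<alpha> = wt b" "b \<in> B" by blast
  then show "\<alpha> \<in> roots \<tt> UNIV"
    using wt_dual[of b] wt_space[of b] basis_nonzero[of b] by (auto simp: roots_def weight_space_def)
qed

lemma finite_roots: "finite (roots \<tt> UNIV)"
  by (rule finite_subset[of _ "wt ` B"]) (use roots_iff finite_B in auto)

lemma roots_dual: "\<alpha> \<in> roots \<tt> UNIV \<Longrightarrow> \<alpha> \<in> dual \<tt>"
  by (simp add: roots_def)

text \<open>With h = [x, y], two evaluations of the Killing form at h give
  \<open>killing x y\<close> as a positive rational multiple of \<alpha> h. Division by it makes the
  commutator represent \<alpha>, and in the weights at the rescaled commutator the unknown factor
  \<alpha> h cancels.\<close>

lemma root_representative:
  assumes \<alpha>: "\<alpha> \<in> roots \<tt> UNIV"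
  obtains x y where "x \<in> weight_space \<tt> \<alpha>" "y \<in> weight_space \<tt> (- \<alpha>)"
    "\<And>h. h \<in> \<tt> \<Longrightarrow> killing (lie x y) h = \<alpha> h" "\<And>b. b \<in> B \<Longrightarrow> wt b (lie x y) \<in> \<rat>"
proof -
  note d = roots_dual[OF \<alpha>]
  obtain x y where x: "x \<in> weight_space \<tt> \<alpha>" and y: "y \<in> weight_space \<tt> (- \<alpha>)"
    and nz: "\<alpha> (lie x y) \<noteq> 0" using root_commutator_nonzero[OF \<alpha>] by blast
  let ?h = "lie x y" and ?c = "killing x y"
  have h: "?h \<in> \<tt>" by (rule lie_mem[OF x y])
  obtain p where p: "p > 0" "killing ?h ?h = of_rat p * (\<alpha> ?h)\<^sup>2"
    using killing_string[OF x y d nz] by blast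
  have "\<alpha> ?h * ?c = \<alpha> ?h * (of_rat p * \<alpha> ?h)"
    using p(2) killing_commutator[OF x h, of y] by (simp add: power2_eq_square)
  then have c: "?c = of_rat p * \<alpha> ?h" using nz by simp
  then have c0: "?c \<noteq> 0" using nz p(1) by simp
  let ?x = "(1 / ?c) *\<^sub>c x"
  have l: "lie ?x y = (1 / ?c) *\<^sub>c ?h" by (simp add: lie_scaleC_left)
  show thesis
  proof (rule that)
    show "?x \<in> weight_space \<tt> \<alpha>" by (rule cvec.subspace_scale[OF weight_space_subspace x])
    show "killing (lie ?x y) k = \<alpha> k" if "k \<in> \<tt>" for k
      using killing_commutator[OF x that, of y] c0
      by (simp add: l killing_scale_left killing_commute[of ?h])
    show "wt b (lie ?x y) \<in> \<rat>" if b: "b \<in> B" for b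
    proof -
      obtain q where q: "wt b ?h = of_rat q * \<alpha> ?h" using string_rational[OF x y d b] by blast
      have "wt b (lie ?x y) = (1 / ?c) * wt b ?h"
        unfolding l by (rule dual_apply_scale[OF wt_dual[OF b] h])
      also have "\<dots> = of_rat (q / p)"
        unfolding q c using nz p(1) by (simp add: of_rat_divide)
      finally have "wt b (lie ?x y) = of_rat (q / p)" .
      then show ?thesis by simp
    qed
  qed (rule y)
qed

text \<open>Every nonzero weight is the pairing with some commutator in \<open>\<tt>\<close>, so all
  weights vanish at \<open>h\<close>. Thus existence of representatives comes before nondegeneracy,
  which then supplies the uniqueness behind \<open>killing_rep\<close>.\<close>

lemma killing_nondegenerate:
  assumes h: "h \<in> \<tt>" and z: "\<And>k. k \<in> \<tt> \<Longrightarrow> killing h k = 0"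
  shows "h = 0"
proof (rule weights_separate[OF h])
  fix b assume b: "b \<in> B"
  show "wt b h = 0"
  proof (cases "wt b = 0")
    case False
    then have "wt b \<in> roots \<tt> UNIV" using b roots_iff by blast
    then obtain x y where "x \<in> weight_space \<tt> (wt b)" "y \<in> weight_space \<tt> (- wt b)"
      "\<And>h. h \<in> \<tt> \<Longrightarrow> killing (lie x y) h = wt b h" by (rule root_representative) blast
    then show ?thesis using z[OF lie_mem] h killing_commute by metis
  qed simp
qed

lemma killing_rep_eqI:
  assumes h: "h \<in> \<tt>" and r: "\<And>k. k \<in> \<tt> \<Longrightarrow> killing h k = l k"
  shows "killing_rep \<tt> l = h"
  unfolding killing_rep_def
proof (rule the_equality)
  show "h \<in> \<tt> \<and> (\<forall>x\<in>\<tt>. killing h x = l x)" using assms by blast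
  fix h' assume h': "h' \<in> \<tt> \<and> (\<forall>x\<in>\<tt>. killing h' x = l x)"
  have "h' - h = 0"
    by (rule killing_nondegenerate)
      (use h h' r in \<open>simp_all add: cvec.subspace_diff[OF subspace] killing_diff_left\<close>)
  then show "h' = h" by simp
qed

lemma killing_rep_root:
  assumes \<alpha>: "\<alpha> \<in> roots \<tt> UNIV"
  obtains x y where "x \<in> weight_space \<tt> \<alpha>" "y \<in> weight_space \<tt> (- \<alpha>)" "lie x y = killing_rep \<tt> \<alpha>"
    "killing_rep \<tt> \<alpha> \<in> \<tt>" "\<And>h. h \<in> \<tt> \<Longrightarrow> killing (killing_rep \<tt> \<alpha>) h = \<alpha> h"
    "\<And>b. b \<in> B \<Longrightarrow> wt b (killing_rep \<tt> \<alpha>) \<in> \<rat>"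
proof -
  obtain x y where xy: "x \<in> weight_space \<tt> \<alpha>" "y \<in> weight_space \<tt> (- \<alpha>)"
    "\<And>h. h \<in> \<tt> \<Longrightarrow> killing (lie x y) h = \<alpha> h" "\<And>b. b \<in> B \<Longrightarrow> wt b (lie x y) \<in> \<rat>"
    using root_representative[OF \<alpha>] by blast
  have "killing_rep \<tt> \<alpha> = lie x y" by (rule killing_rep_eqI[OF lie_mem[OF xy(1,2)] xy(3)])
  then show thesis using that[of x y] xy lie_mem[OF xy(1,2)] by simp
qed

lemma killing_rep_mem: "\<alpha> \<in> roots \<tt> UNIV \<Longrightarrow> killing_rep \<tt> \<alpha> \<in> \<tt>"
  by (rule killing_rep_root)

lemma killing_killing_rep:
  assumes "\<alpha> \<in> roots \<tt> UNIV" "h \<in> \<tt>"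
  shows "killing (killing_rep \<tt> \<alpha>) h = \<alpha> h"
  by (rule killing_rep_root[OF assms(1)]) (use assms(2) in blast)

lemma wt_killing_rep_rational:
  assumes "\<alpha> \<in> roots \<tt> UNIV" "b \<in> B"
  shows "wt b (killing_rep \<tt> \<alpha>) \<in> \<rat>"
  by (rule killing_rep_root[OF assms(1)]) (use assms(2) in blast)

lemma root_killing_rep_rational:
  assumes "\<alpha> \<in> roots \<tt> UNIV" "\<beta> \<in> roots \<tt> UNIV"
  shows "\<beta> (killing_rep \<tt> \<alpha>) \<in> \<rat>"
proof -
  obtain b where "b \<in> B" "\<beta> = wt b" using assms(2) unfolding roots_iff by blast
  then show ?thesis using wt_killing_rep_rational[OF assms(1)] by simp
qed

lemma dual_form_root:
  assumes "\<alpha> \<in> roots \<tt> UNIV" "\<beta> \<in> roots \<tt> UNIV"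
  shows "dual_form \<tt> \<alpha> \<beta> = \<alpha> (killing_rep \<tt> \<beta>)"
  by (simp add: dual_form_def killing_killing_rep assms killing_rep_mem)

lemma root_killing_rep_commute:
  assumes "\<alpha> \<in> roots \<tt> UNIV" "\<beta> \<in> roots \<tt> UNIV"
  shows "\<alpha> (killing_rep \<tt> \<beta>) = \<beta> (killing_rep \<tt> \<alpha>)"
  using dual_form_root[OF assms] dual_form_root[OF assms(2,1)]
  by (simp add: dual_form_def killing_commute)

text \<open>The weights are rational at the sum \<open>u M\<close> of the representatives, so the
  form there is a sum of rational squares; if it is not positive, all weights vanish at
  \<open>u M\<close>. Multisets of roots express all integral combinations, since negatives of roots
  are roots, and spare a linear extension of \<open>killing_rep\<close>.\<close>

lemma form_definite:
  assumes M: "set_mset M \<subseteq> roots \<tt> UNIV"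
    and le: "Re (\<Sum>\<beta>\<in>#M. (\<Sum>\<^sub># M) (killing_rep \<tt> \<beta>)) \<le> 0"
  shows "\<Sum>\<^sub># M = 0"
proof -
  define u where "u N = (\<Sum>\<beta>\<in>#N. killing_rep \<tt> \<beta>)" for N
  have sum: "\<Sum>\<^sub># N \<in> dual \<tt> \<and> u N \<in> \<tt> \<and> (\<forall>h\<in>\<tt>. killing (u N) h = (\<Sum>\<^sub># N) h)
      \<and> (\<forall>l\<in>dual \<tt>. l (u N) = (\<Sum>\<beta>\<in>#N. l (killing_rep \<tt> \<beta>))) \<and> (\<forall>b\<in>B. wt b (u N) \<in> \<rat>)"
    if "set_mset N \<subseteq> roots \<tt> UNIV" for N
    using that
  proof (induction N)
    case empty
    have "wt b 0 = 0" if "b \<in> B" for b by (rule dual_apply_zero[OF wt_dual[OF that]])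
    then show ?case
      using dual_zero[of \<tt>, unfolded zero_fun_def] dual_apply_zero[of _ \<tt>] cvec.subspace_0[OF subspace] by (auto simp: u_def)
  next
    case (add \<alpha> N)
    then have \<alpha>: "\<alpha> \<in> roots \<tt> UNIV"
      and IH: "\<Sum>\<^sub># N \<in> dual \<tt> \<and> u N \<in> \<tt> \<and> (\<forall>h\<in>\<tt>. killing (u N) h = (\<Sum>\<^sub># N) h)
        \<and> (\<forall>l\<in>dual \<tt>. l (u N) = (\<Sum>\<beta>\<in>#N. l (killing_rep \<tt> \<beta>))) \<and> (\<forall>b\<in>B. wt b (u N) \<in> \<rat>)"
      by auto
    have u: "u (add_mset \<alpha> N) = killing_rep \<tt> \<alpha> + u N" by (simp add: u_def)
    have d: "l (killing_rep \<tt> \<alpha> + u N) = l (killing_rep \<tt> \<alpha>) + l (u N)" if "l \<in> dual \<tt>" for l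
      using dual_apply_add[OF that killing_rep_mem[OF \<alpha>]] IH by blast
    show ?case
      unfolding u
    proof (intro conjI ballI)
      show "\<Sum>\<^sub># (add_mset \<alpha> N) \<in> dual \<tt>"
        using dual_add[OF roots_dual[OF \<alpha>]] IH unfolding sum_mset.add_mset by blast
      show "killing_rep \<tt> \<alpha> + u N \<in> \<tt>"
        using IH killing_rep_mem[OF \<alpha>] cvec.subspace_add[OF subspace] by blast
      show "killing (killing_rep \<tt> \<alpha> + u N) h = (\<Sum>\<^sub># (add_mset \<alpha> N)) h" if "h \<in> \<tt>" for h
        using IH that by (simp add: killing_add_left killing_killing_rep[OF \<alpha>])
      show "l (killing_rep \<tt> \<alpha> + u N) = (\<Sum>\<beta>\<in>#add_mset \<alpha> N. l (killing_rep \<tt> \<beta>))"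
        if "l \<in> dual \<tt>" for l
        using IH that unfolding d[OF that] by simp
      show "wt b (killing_rep \<tt> \<alpha> + u N) \<in> \<rat>" if "b \<in> B" for b
        unfolding d[OF wt_dual[OF that]] using IH that wt_killing_rep_rational[OF \<alpha> that] by simp
    qed
  qed
  note s = sum[OF M]
  then have u: "u M \<in> \<tt>" by blast
  obtain q where q: "\<And>b. b \<in> B \<Longrightarrow> wt b (u M) = of_rat (q b)"
  proof -
    have "\<forall>b. \<exists>q. b \<in> B \<longrightarrow> wt b (u M) = of_rat q" using s by (meson Rats_cases)
    then show thesis using that by metis
  qed
  have "(\<Sum>\<beta>\<in>#M. (\<Sum>\<^sub># M) (killing_rep \<tt> \<beta>)) = (\<Sum>\<^sub># M) (u M)" using s by metis
  also have "\<dots> = killing (u M) (u M)" using s by metis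
  also have "\<dots> = of_rat (\<Sum>b\<in>B. (q b)\<^sup>2)"
    unfolding killing_cartan[OF u u] of_rat_sum
    by (rule sum.cong) (simp_all add: q power2_eq_square of_rat_mult)
  also have "\<dots> = of_real (of_rat (\<Sum>b\<in>B. (q b)\<^sup>2))"
    by (rule complex_of_rat_conv)
  finally have "(\<Sum>b\<in>B. (q b)\<^sup>2) \<le> 0" using le by (simp add: of_rat_le_0_iff)
  then have "(\<Sum>b\<in>B. (q b)\<^sup>2) = 0" by (intro antisym sum_nonneg) auto
  then have "\<forall>b\<in>B. q b = 0" using finite_B by (simp add: sum_nonneg_eq_0_iff)
  then have "u M = 0" using s q by (intro weights_separate) auto
  then show ?thesis using s dual_zero by (intro dual_eqI[of _ \<tt>]) auto
qed

lemma root_norm_pos: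
  assumes "\<alpha> \<in> roots \<tt> UNIV"
  shows "Re (\<alpha> (killing_rep \<tt> \<alpha>)) > 0"
proof (rule ccontr)
  assume "\<not> ?thesis"
  then have "\<Sum>\<^sub># {#\<alpha>#} = 0" using assms by (intro form_definite) auto
  then show False using assms by (simp add: roots_iff)
qed

text \<open>If \<open>\<beta> - \<gamma>\<close> is not a weight, then the weight spaces for \<open>\<beta> + n \<gamma>\<close> with \<open>n \<ge> 0\<close> span a submodule for the
  \<open>sl\<^sub>2\<close> of \<open>\<gamma>\<close>, on which a commutator has trace zero.\<close>

lemma root_ray:
  assumes \<beta>: "\<beta> \<in> roots \<tt> UNIV" and \<gamma>: "\<gamma> \<in> roots \<tt> UNIV"
    and nw: "\<beta> - \<gamma> \<notin> wt ` B" and nonneg: "Re (\<beta> (killing_rep \<tt> \<gamma>)) \<ge> 0"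
  shows "\<beta> (killing_rep \<tt> \<gamma>) = 0 \<and> \<beta> + \<gamma> \<notin> wt ` B"
proof -
  let ?t = "killing_rep \<tt> \<gamma>"
  obtain x y where x: "x \<in> weight_space \<tt> \<gamma>" and y: "y \<in> weight_space \<tt> (- \<gamma>)" and xy: "lie x y = ?t"
    by (rule killing_rep_root[OF \<gamma>])
  define s where "s n = \<beta> + (\<lambda>z. of_nat n * \<gamma> z)" for n
  define C where "C = {b\<in>B. wt b \<in> range s}"
  have s0: "s 0 = \<beta>" and s1: "s 1 = \<beta> + \<gamma>" by (simp_all add: s_def fun_eq_iff)
  have up: "s n + \<gamma> = s (Suc n)" and down: "s (Suc n) - \<gamma> = s n" for n
    by (simp_all add: s_def fun_eq_iff algebra_simps)
  have "(\<Sum>b\<in>C. wt b ?t) = 0"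
    unfolding C_def xy[symmetric]
  proof (rule trace_commutator[OF x y roots_dual[OF \<gamma>]])
    fix b assume "b \<in> B" and "wt b \<in> range s"
    then obtain n where n: "wt b = s n" by blast
    show "wt b + \<gamma> \<in> range s \<or> wt b + \<gamma> \<notin> wt ` B" unfolding n up by blast
    show "wt b - \<gamma> \<in> range s \<or> wt b - \<gamma> \<notin> wt ` B"
    proof (cases n)
      case 0
      then show ?thesis using nw n s0 by simp
    next
      case (Suc m)
      then show ?thesis unfolding n using down by simp
    qed
  qed
  then have sum: "(\<Sum>b\<in>C. Re (wt b ?t)) = 0" by (simp flip: Re_sum)
  have "finite C" using finite_B by (simp add: C_def)
  \<comment> \<open>Along the ray the real parts are those of (\<beta>, \<gamma>) + n (\<gamma>,
    \<gamma>), none negative, so a zero sum makes each vanish. For n = 0 this gives orthogonality;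
    at n = 1 it would contradict (\<gamma>, \<gamma>) > 0.\<close>
  moreover have "Re (wt b ?t) \<ge> 0" if "b \<in> C" for b
    using that nonneg root_norm_pos[OF \<gamma>] by (auto simp: C_def s_def)
  ultimately have z: "Re (wt b ?t) = 0" if "b \<in> C" for b
    using sum_nonneg_0[of C "\<lambda>b. Re (wt b ?t)"] sum that by blast
  obtain b where b: "b \<in> B" "wt b = \<beta>" using \<beta> unfolding roots_iff by blast
  then have "b \<in> C" using s0[symmetric] by (simp add: C_def)
  then have re: "Re (\<beta> ?t) = 0" using z b by blast
  obtain q where "\<beta> ?t = of_rat q" using root_killing_rep_rational[OF \<gamma> \<beta>] by (rule Rats_cases)
  with re have "\<beta> ?t = 0" by (simp add: complex_of_rat_conv)
  moreover have "\<beta> + \<gamma> \<notin> wt ` B"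
  proof
    assume "\<beta> + \<gamma> \<in> wt ` B"
    then obtain c where c: "c \<in> B" "wt c = \<beta> + \<gamma>" by force
    then have "c \<in> C" using s1[symmetric] by (simp add: C_def)
    then show False using z[of c] c re root_norm_pos[OF \<gamma>] by simp
  qed
  ultimately show ?thesis by blast
qed

end

section \<open>Positive systems\<close>

lemma sum_fun_apply: "(\<Sum>i\<in>S. f i) x = (\<Sum>i\<in>S. f i x)"
  for f :: "'i \<Rightarrow> 'a \<Rightarrow> 'b::comm_monoid_add"
  by (induction S rule: infinite_finite_induct) simp_all

lemma sum_mset_minus_msets:
  fixes X Y :: "'b::ab_group_add multiset"
  assumes "\<Sum>\<^sub># X = \<Sum>\<^sub># Y"
  shows "\<Sum>\<^sub># (X - Y) = \<Sum>\<^sub># (Y - X)"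
proof -
  have "\<Sum>\<^sub># (X - Y) + \<Sum>\<^sub># (X \<inter># Y) = \<Sum>\<^sub># X" "\<Sum>\<^sub># (Y - X) + \<Sum>\<^sub># (X \<inter># Y) = \<Sum>\<^sub># Y"
    unfolding sum_mset.union[symmetric]
    by (rule arg_cong[where f=sum_mset], rule multiset_eqI, simp)+
  then show ?thesis using assms by (metis add_right_cancel)
qed

lemma common_denominator:
  fixes q :: "'b \<Rightarrow> rat"
  assumes "finite S"
  shows "\<exists>N>0. \<forall>i\<in>S. \<exists>k. of_int N * q i = of_int k"
  using assms
proof (induction S rule: finite_induct)
  case (insert j S)
  then obtain N where N: "N > 0" "\<And>i. i \<in> S \<Longrightarrow> \<exists>k. of_int N * q i = of_int k" by blast
  obtain a b where ab: "q j = of_int a / of_int b" "b > 0"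
    by (metis quotient_of_denom_pos surj_pair quotient_of_div)
  have "\<exists>k. of_int (N * b) * q i = of_int k" if "i \<in> insert j S" for i
  proof (cases "i = j")
    case True
    then have "of_int (N * b) * q i = of_int (N * a)" using ab by simp
    then show ?thesis by blast
  next
    case False
    then obtain k where "of_int N * q i = of_int k" using N(2) \<open>i \<in> insert j S\<close> by blast
    then have "of_int (N * b) * q i = of_int (b * k)" by (simp add: algebra_simps)
    then show ?thesis by blast
  qed
  then show ?case using N(1) ab(2) by (intro exI[of _ "N * b"]) simp
qed (intro exI[of _ 1], simp)

text \<open>The map is the coordinate at 1 in a basis of the complex numbers over the rationals that
  contains 1.\<close>

lemma rational_functional:
  "\<exists>\<phi> :: complex \<Rightarrow> rat. \<phi> 1 = 1 \<and> (\<forall>x y. \<phi> (x + y) = \<phi> x + \<phi> y) \<and> (\<forall>q x. \<phi> (of_rat q * x) = q * \<phi> x)"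
proof -
  interpret V: vector_space "\<lambda>(q::rat) (z::complex). of_rat q * z"
    by unfold_locales (simp_all add: algebra_simps of_rat_add of_rat_mult)
  have i: "V.independent {1}" by simp
  note E = V.independent_extend_basis[OF i] V.span_extend_basis[OF i] V.extend_basis_superset[OF i]
  let ?\<phi> = "\<lambda>z. V.representation (V.extend_basis {1}) z 1"
  have "?\<phi> 1 = 1" using V.representation_basis[OF E(1), of 1] E(3) by simp
  moreover have "?\<phi> (x + y) = ?\<phi> x + ?\<phi> y" for x y
    using V.representation_add[OF E(1)] E(2) by simp
  moreover have "?\<phi> (of_rat q * x) = q * ?\<phi> x" for q x
    using V.representation_scale[OF E(1)] E(2) by simp
  ultimately show ?thesis by (intro exI[of _ ?\<phi>] conjI allI)
qed

text \<open>\<open>T \<alpha>\<close> is the vector that represents \<open>\<alpha>\<close>, so that \<open>\<beta> (T \<alpha>)\<close> is the inner product of the roots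
  \<open>\<alpha>\<close> and \<open>\<beta>\<close>.\<close>

locale positive_roots =
  fixes \<Phi> P :: "('a \<Rightarrow> complex) set" and T :: "('a \<Rightarrow> complex) \<Rightarrow> 'a"
  assumes positive: "positive_system \<Phi> P" and finite_P: "finite P" and zero: "0 \<notin> \<Phi>"
    and rational: "\<alpha> \<in> \<Phi> \<Longrightarrow> \<beta> \<in> \<Phi> \<Longrightarrow> \<alpha> (T \<beta>) \<in> \<rat>"
    and commute: "\<alpha> \<in> \<Phi> \<Longrightarrow> \<beta> \<in> \<Phi> \<Longrightarrow> \<alpha> (T \<beta>) = \<beta> (T \<alpha>)"
    and definite: "set_mset M \<subseteq> \<Phi> \<Longrightarrow> Re (\<Sum>\<beta>\<in>#M. (\<Sum>\<^sub># M) (T \<beta>)) \<le> 0 \<Longrightarrow> \<Sum>\<^sub># M = 0"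
    and diff_root: "\<alpha> \<in> \<Phi> \<Longrightarrow> \<beta> \<in> \<Phi> \<Longrightarrow> Re (\<alpha> (T \<beta>)) > 0 \<Longrightarrow> \<alpha> \<noteq> \<beta> \<Longrightarrow> \<alpha> - \<beta> \<in> \<Phi>"
    and orthogonal_root:
      "\<alpha> \<in> \<Phi> \<Longrightarrow> \<beta> \<in> \<Phi> \<Longrightarrow> \<alpha> (T \<beta>) = 0 \<Longrightarrow> \<alpha> + \<beta> \<in> \<Phi> \<Longrightarrow> \<alpha> - \<beta> \<in> \<Phi>"
begin

abbreviation "\<Delta> \<equiv> simple_roots P"

lemma P_subset: "P \<subseteq> \<Phi>" and uminus_closed: "\<alpha> \<in> \<Phi> \<Longrightarrow> - \<alpha> \<in> \<Phi>"
  and P_disjoint: "\<alpha> \<in> P \<Longrightarrow> - \<alpha> \<notin> P" and P_cases: "\<alpha> \<in> \<Phi> \<Longrightarrow> \<alpha> \<in> P \<or> - \<alpha> \<in> P"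
  and P_add: "\<alpha> \<in> P \<Longrightarrow> \<beta> \<in> P \<Longrightarrow> \<alpha> + \<beta> \<in> \<Phi> \<Longrightarrow> \<alpha> + \<beta> \<in> P"
  using positive unfolding positive_system_def by (auto simp: image_iff)

lemma simple_subset: "\<Delta> \<subseteq> P" by (auto simp: simple_roots_def)

lemma norm_pos: "\<alpha> \<in> \<Phi> \<Longrightarrow> Re (\<alpha> (T \<alpha>)) > 0"
  using definite[of "{#\<alpha>#}"] zero by force

text \<open>If the sum were zero, the inner products of \<alpha> with the other members would add up
  to a negative number, so some \<beta> has a negative one. Then \<alpha> + \<beta> is a positive
  root and replaces two members of the multiset by one.\<close>

lemma sum_positive_roots_nonzero:
  assumes "set_mset M \<subseteq> P" "M \<noteq> {#}"
  shows "\<Sum>\<^sub># M \<noteq> 0"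
  using assms
proof (induction "size M" arbitrary: M rule: less_induct)
  case less
  then obtain \<alpha> N where M: "M = add_mset \<alpha> N" by (metis multiset_cases)
  then have \<alpha>: "\<alpha> \<in> P" and N: "set_mset N \<subseteq> P" using less.prems by auto
  show ?case
  proof
    assume z: "\<Sum>\<^sub># M = 0"
    have "(\<Sum>\<beta>\<in>#N. \<beta> (T \<alpha>)) = - \<alpha> (T \<alpha>)"
      using fun_cong[OF z, of "T \<alpha>"] M
      by (simp add: eq_neg_iff_add_eq_0 add.commute sum_mset_fun_apply)
    then have neg: "Re (\<Sum>\<beta>\<in>#N. \<beta> (T \<alpha>)) < 0" using norm_pos \<alpha> P_subset by auto
    have "\<exists>\<beta>\<in>#N. Re (\<beta> (T \<alpha>)) < 0"
    proof (rule ccontr)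
      assume "\<not> ?thesis"
      then have "\<forall>\<beta>\<in>#N. 0 \<le> Re (\<beta> (T \<alpha>))" by auto
      then have "0 \<le> Re (\<Sum>\<beta>\<in>#N. \<beta> (T \<alpha>))" by (induction N) auto
      then show False using neg by simp
    qed
    then obtain \<beta> where \<beta>: "\<beta> \<in># N" "Re (\<beta> (T \<alpha>)) < 0" by blast
    have \<beta>P: "\<beta> \<in> P" using \<beta>(1) N by blast
    have in\<Phi>: "\<alpha> \<in> \<Phi>" "\<beta> \<in> \<Phi>" "- \<beta> \<in> \<Phi>" using \<alpha> \<beta>P P_subset uminus_closed by auto
    have "\<alpha> (T (- \<beta>)) = - \<beta> (T \<alpha>)" using commute[OF in\<Phi>(1,3)] by simp
    moreover have "\<alpha> \<noteq> - \<beta>" using P_disjoint[OF \<beta>P] \<alpha> by auto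
    ultimately have "\<alpha> - (- \<beta>) \<in> \<Phi>" using \<beta>(2) by (intro diff_root in\<Phi>) auto
    then have ab: "\<alpha> + \<beta> \<in> P" using P_add \<alpha> \<beta>P by simp
    obtain N' where N': "N = add_mset \<beta> N'" using \<beta>(1) by (metis multi_member_split)
    have "\<Sum>\<^sub># (add_mset (\<alpha> + \<beta>) N') \<noteq> 0"
      by (rule less.hyps) (use ab N N' M in auto)
    then show False using z M N' by (simp add: add.assoc)
  qed
qed

text \<open>The roots that differ from \<open>\<alpha>\<close> by a nonempty sum of positive roots serve as a termination measure.\<close>

lemma positive_root_decomposition:
  assumes "\<alpha> \<in> P"
  shows "\<exists>M. set_mset M \<subseteq> \<Delta> \<and> \<Sum>\<^sub># M = \<alpha>"
proof -
  define below where "below \<alpha> = {\<beta>\<in>P. \<exists>M. M \<noteq> {#} \<and> set_mset M \<subseteq> P \<and> \<alpha> = \<beta> + \<Sum>\<^sub># M}" for \<alpha>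
  have below_less: "card (below \<beta>) < card (below \<alpha>)" if "\<alpha> = \<beta> + \<gamma>" "\<beta> \<in> P" "\<gamma> \<in> P" for \<alpha> \<beta> \<gamma>
  proof (rule psubset_card_mono)
    show "finite (below \<alpha>)" using finite_P by (simp add: below_def)
    have "\<delta> \<in> below \<alpha>" if \<delta>: "\<delta> \<in> below \<beta>" for \<delta>
    proof -
      obtain M where "\<delta> \<in> P" "M \<noteq> {#}" "set_mset M \<subseteq> P" "\<beta> = \<delta> + \<Sum>\<^sub># M"
        using \<delta> unfolding below_def by blast
      then show ?thesis unfolding below_def \<open>\<alpha> = \<beta> + \<gamma>\<close> using \<open>\<gamma> \<in> P\<close>
        by (intro CollectI conjI exI[of _ "add_mset \<gamma> M"]) (auto simp: ac_simps)
    qed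
    moreover have "\<beta> \<in> below \<alpha>"
      unfolding below_def \<open>\<alpha> = \<beta> + \<gamma>\<close> using that
      by (intro CollectI conjI exI[of _ "{#\<gamma>#}"]) auto
    moreover have "\<beta> \<notin> below \<beta>" using sum_positive_roots_nonzero by (auto simp: below_def)
    ultimately show "below \<beta> \<subset> below \<alpha>" by blast
  qed
  show ?thesis using assms
  proof (induction "card (below \<alpha>)" arbitrary: \<alpha> rule: less_induct)
    case (less \<alpha>)
    show ?case
    proof (cases "\<alpha> \<in> \<Delta>")
      case True
      then show ?thesis by (intro exI[of _ "{#\<alpha>#}"]) simp
    next
      case False
      then obtain \<beta> \<gamma> where bc: "\<alpha> = \<beta> + \<gamma>" "\<beta> \<in> P" "\<gamma> \<in> P"
        using less.prems by (auto simp: simple_roots_def)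
      have cb: "\<alpha> = \<gamma> + \<beta>" using bc(1) by (simp add: add.commute)
      obtain M where M: "set_mset M \<subseteq> \<Delta>" "\<Sum>\<^sub># M = \<beta>"
        using less.hyps[OF below_less[OF bc] bc(2)]
        by blast
      obtain N where N: "set_mset N \<subseteq> \<Delta>" "\<Sum>\<^sub># N = \<gamma>"
        using less.hyps[OF below_less[OF cb bc(3,2)] bc(3)]
        by blast
      show ?thesis using M N bc(1) by (intro exI[of _ "M + N"]) auto
    qed
  qed
qed

text \<open>Otherwise the difference of the two roots is a root, and whichever sign makes it
  positive exhibits one of the simple roots as a sum of positive roots.\<close>

lemma simple_obtuse:
  assumes "\<alpha> \<in> \<Delta>" "\<beta> \<in> \<Delta>" "\<alpha> \<noteq> \<beta>"
  shows "Re (\<alpha> (T \<beta>)) \<le> 0"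
proof (rule ccontr)
  assume "\<not> ?thesis"
  then have "\<alpha> - \<beta> \<in> \<Phi>" using assms simple_subset P_subset by (intro diff_root) auto
  then consider "\<alpha> - \<beta> \<in> P" | "\<beta> - \<alpha> \<in> P" using P_cases by force
  then show False
  proof cases
    case 1
    have "\<alpha> = (\<alpha> - \<beta>) + \<beta>" by simp
    then show False using 1 assms simple_subset unfolding simple_roots_def by blast
  next
    case 2
    have "\<beta> = (\<beta> - \<alpha>) + \<alpha>" by simp
    then show False using 2 assms simple_subset unfolding simple_roots_def by blast
  qed
qed

text \<open>After cancelling the common part, the common sum has a norm that pairs only distinct
  simple roots, so it is at most 0 and the sum is zero by definiteness. Nonempty multisets of
  positive roots do not sum to zero.\<close>

lemma simple_multiset_unique:
  assumes X: "set_mset X \<subseteq> \<Delta>" and Y: "set_mset Y \<subseteq> \<Delta>" and eq: "\<Sum>\<^sub># X = \<Sum>\<^sub># Y"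
  shows "X = Y"
proof -
  let ?X = "X - Y" and ?Y = "Y - X"
  have eq': "\<Sum>\<^sub># ?X = \<Sum>\<^sub># ?Y" using sum_mset_minus_msets[OF eq] .
  have sub: "set_mset ?X \<subseteq> \<Delta>" "set_mset ?Y \<subseteq> \<Delta>" using X Y by (auto dest: in_diffD)
  have le: "Re (\<alpha> (T \<beta>)) \<le> 0" if "\<alpha> \<in># ?X" "\<beta> \<in># ?Y" for \<alpha> \<beta>
  proof (rule simple_obtuse)
    show "\<alpha> \<in> \<Delta>" "\<beta> \<in> \<Delta>" using sub that by auto
    show "\<alpha> \<noteq> \<beta>" using that by (auto simp: in_diff_count)
  qed
  have nonpos: "Re (\<Sum>x\<in>#M. f x) \<le> 0" if "\<And>x. x \<in># M \<Longrightarrow> Re (f x) \<le> 0" for M and f :: "('a \<Rightarrow> complex) \<Rightarrow> complex"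
    using that by (induction M) (auto intro: add_nonpos_nonpos)
  have "Re (\<Sum>\<beta>\<in>#?Y. (\<Sum>\<^sub># ?Y) (T \<beta>)) \<le> 0"
    unfolding eq'[symmetric] sum_mset_fun_apply by (intro nonpos le)
  then have z: "\<Sum>\<^sub># ?Y = 0" using sub simple_subset P_subset by (intro definite) auto
  then have "?Y = {#}" "?X = {#}"
    using sum_positive_roots_nonzero sub simple_subset eq' by (metis order_trans)+
  then show ?thesis by (metis Diff_eq_empty_iff_mset subset_mset.antisym)
qed

text \<open>Needed because a relation with rationalized coefficients is known only at the vectors
  \<open>T \<beta>\<close>. Definiteness evaluates sums of roots at such vectors only.\<close>

lemma simple_multiset_unique_rational:
  assumes X: "set_mset X \<subseteq> \<Delta>" and Y: "set_mset Y \<subseteq> \<Delta>"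
    and eq: "\<And>\<beta>. \<beta> \<in> \<Phi> \<Longrightarrow> (\<Sum>\<^sub># X) (T \<beta>) = (\<Sum>\<^sub># Y) (T \<beta>)"
  shows "X = Y"
proof -
  define M where "M = X + image_mset uminus Y"
  have neg: "\<Sum>\<^sub># (image_mset uminus Y) = - \<Sum>\<^sub># Y" by (induction Y) simp_all
  then have M: "\<Sum>\<^sub># M = \<Sum>\<^sub># X - \<Sum>\<^sub># Y" by (simp add: M_def)
  have sub: "set_mset M \<subseteq> \<Phi>"
    using X Y simple_subset P_subset unfolding M_def by (auto intro!: uminus_closed)
  have "(\<Sum>\<beta>\<in>#M. (\<Sum>\<^sub># M) (T \<beta>)) = (\<Sum>\<beta>\<in>#M. 0)"
    by (intro arg_cong[where f=sum_mset] image_mset_cong) (use sub eq M in auto)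
  then have "\<Sum>\<^sub># M = 0" by (intro definite[OF sub]) simp
  then show ?thesis using M by (intro simple_multiset_unique[OF X Y]) simp
qed

text \<open>A linear relation with complex coefficients, one of them \<open>1\<close>, is turned into one with rational
  coefficients by a \<open>\<rat>\<close>-linear map \<open>\<complex> \<rightarrow> \<rat>\<close> that fixes \<open>1\<close>, since the inner products are rational.\<close>

lemma simple_independent: "functional.independent \<Delta>"
proof (rule functional.independent_if_scalars_zero)
  show fin: "finite \<Delta>" using simple_subset finite_P by (rule finite_subset)
  fix c :: "('a \<Rightarrow> complex) \<Rightarrow> complex" and \<delta>0
  assume sum: "(\<Sum>\<delta>\<in>\<Delta>. (\<lambda>x. c \<delta> * \<delta> x)) = 0" and \<delta>0: "\<delta>0 \<in> \<Delta>"
  show "c \<delta>0 = 0"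
  proof (rule ccontr)
    assume nz: "c \<delta>0 \<noteq> 0"
    obtain \<phi> :: "complex \<Rightarrow> rat" where \<phi>: "\<phi> 1 = 1" "\<And>x y. \<phi> (x + y) = \<phi> x + \<phi> y"
      "\<And>q x. \<phi> (of_rat q * x) = q * \<phi> x"
      using rational_functional by blast
    have \<phi>0: "\<phi> 0 = 0" using \<phi>(3)[of 0 0] by simp
    have \<phi>_sum: "\<phi> (\<Sum>i\<in>S. f i) = (\<Sum>i\<in>S. \<phi> (f i))" for S and f :: "('a \<Rightarrow> complex) \<Rightarrow> complex"
      by (induction S rule: infinite_finite_induct) (simp_all add: \<phi>0 \<phi>(2))
    define q where "q \<delta> = \<phi> (c \<delta> / c \<delta>0)" for \<delta>
    have q0: "q \<delta>0 = 1" using nz \<phi>(1) by (simp add: q_def)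
    have q: "(\<Sum>\<delta>\<in>\<Delta>. of_rat (q \<delta>) * \<delta> (T \<beta>)) = 0" if \<beta>: "\<beta> \<in> \<Phi>" for \<beta>
    proof -
      have "\<forall>\<delta>. \<exists>r. \<delta> \<in> \<Delta> \<longrightarrow> \<delta> (T \<beta>) = of_rat r"
        using rational[OF _ \<beta>] simple_subset P_subset by (meson Rats_cases subsetD)
      then obtain r where r: "\<And>\<delta>. \<delta> \<in> \<Delta> \<Longrightarrow> \<delta> (T \<beta>) = of_rat (r \<delta>)" by metis
      have "(\<Sum>\<delta>\<in>\<Delta>. c \<delta> * \<delta> (T \<beta>)) = 0"
        using fun_cong[OF sum, of "T \<beta>"] by (simp add: sum_fun_apply)
      then have "(\<Sum>\<delta>\<in>\<Delta>. c \<delta> * \<delta> (T \<beta>)) / c \<delta>0 = 0" by simp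
      then have "(\<Sum>\<delta>\<in>\<Delta>. of_rat (r \<delta>) * (c \<delta> / c \<delta>0)) = 0"
        by (simp add: sum_divide_distrib r mult.commute cong: sum.cong)
      then have "\<phi> (\<Sum>\<delta>\<in>\<Delta>. of_rat (r \<delta>) * (c \<delta> / c \<delta>0)) = 0" by (simp only: \<phi>0)
      then have "(\<Sum>\<delta>\<in>\<Delta>. r \<delta> * q \<delta>) = 0" unfolding \<phi>_sum \<phi>(3) q_def .
      then have "of_rat (\<Sum>\<delta>\<in>\<Delta>. q \<delta> * r \<delta>) = (0::complex)" by (simp add: mult.commute)
      then show ?thesis by (simp add: of_rat_sum of_rat_mult r cong: sum.cong)
    qed
    obtain N where N: "N > 0" "\<forall>\<delta>\<in>\<Delta>. \<exists>k. of_int N * q \<delta> = of_int k"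
      using common_denominator[OF fin] by blast
    then obtain n where n: "\<And>\<delta>. \<delta> \<in> \<Delta> \<Longrightarrow> of_int N * q \<delta> = of_int (n \<delta>)" by metis
    have n0: "n \<delta>0 > 0" using n[OF \<delta>0] q0 N(1) by simp
    \<comment> \<open>Positive and negative part of the integral relation: \<open>nat\<close>
      truncates at 0, so each simple root enters at most one of \<open>X\<close> and
      \<open>Y\<close>.\<close>
    define X where "X = (\<Sum>\<delta>\<in>\<Delta>. replicate_mset (nat (n \<delta>)) \<delta>)"
    define Y where "Y = (\<Sum>\<delta>\<in>\<Delta>. replicate_mset (nat (- n \<delta>)) \<delta>)"
    have ev: "(\<Sum>\<^sub># (\<Sum>\<delta>\<in>S. replicate_mset (m \<delta>) \<delta>)) x = (\<Sum>\<delta>\<in>S. of_nat (m \<delta>) * \<delta> x)"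
      if "finite S" for S m and x :: 'a
      using that by (induction S rule: finite_induct) (simp_all add: sum_mset_fun_apply)
    have set: "set_mset (\<Sum>\<delta>\<in>S. replicate_mset (m \<delta>) \<delta>) \<subseteq> S" if "finite S"
      for S :: "('a \<Rightarrow> complex) set" and m
      using that by (induction S rule: finite_induct) (auto split: if_splits)
    have "X = Y"
    proof (rule simple_multiset_unique_rational)
      show "set_mset X \<subseteq> \<Delta>" "set_mset Y \<subseteq> \<Delta>" unfolding X_def Y_def by (rule set[OF fin])+
      fix \<beta> assume \<beta>: "\<beta> \<in> \<Phi>"
      have "(\<Sum>\<^sub># X) (T \<beta>) - (\<Sum>\<^sub># Y) (T \<beta>)
          = (\<Sum>\<delta>\<in>\<Delta>. (of_nat (nat (n \<delta>)) - of_nat (nat (- n \<delta>))) * \<delta> (T \<beta>))"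
        unfolding X_def Y_def ev[OF fin] by (simp add: sum_subtractf left_diff_distrib)
      also have "\<dots> = (\<Sum>\<delta>\<in>\<Delta>. of_int N * (of_rat (q \<delta>) * \<delta> (T \<beta>)))"
      proof (rule sum.cong[OF refl])
        fix \<delta> assume "\<delta> \<in> \<Delta>"
        have "of_nat (nat (n \<delta>)) - of_nat (nat (- n \<delta>)) = (of_int (n \<delta>) :: complex)"
          by (cases "n \<delta> \<ge> 0") simp_all
        also have "\<dots> = of_rat (of_int (n \<delta>))" by simp
        also have "\<dots> = of_int N * of_rat (q \<delta>)"
          unfolding n[OF \<open>\<delta> \<in> \<Delta>\<close>, symmetric] by (simp add: of_rat_mult)
        finally show "(of_nat (nat (n \<delta>)) - of_nat (nat (- n \<delta>))) * \<delta> (T \<beta>)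
            = of_int N * (of_rat (q \<delta>) * \<delta> (T \<beta>))" by simp
      qed
      also have "\<dots> = 0" using q[OF \<beta>] by (simp flip: sum_distrib_left)
      finally show "(\<Sum>\<^sub># X) (T \<beta>) = (\<Sum>\<^sub># Y) (T \<beta>)" by simp
    qed
    moreover have "count X \<delta>0 = nat (n \<delta>0)" "count Y \<delta>0 = nat (- n \<delta>0)"
      using \<delta>0 fin by (simp_all add: X_def Y_def count_sum if_distrib sum.delta' cong: if_cong)
    ultimately show False using n0 by simp
  qed
qed

text \<open>The coefficients are natural numbers, so a multiset records them all: its size is the
  height of the root, its set of elements the support, and addition of roots is addition of
  multisets, without cancellation.\<close>

definition coords :: "('a \<Rightarrow> complex) \<Rightarrow> ('a \<Rightarrow> complex) multiset" where
  "coords \<alpha> = (THE M. set_mset M \<subseteq> \<Delta> \<and> \<Sum>\<^sub># M = \<alpha>)"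

lemma coords_eqI: "set_mset M \<subseteq> \<Delta> \<Longrightarrow> \<Sum>\<^sub># M = \<alpha> \<Longrightarrow> coords \<alpha> = M"
  unfolding coords_def by (rule the_equality) (auto intro: simple_multiset_unique)

lemma coords:
  assumes "\<alpha> \<in> P"
  shows "set_mset (coords \<alpha>) \<subseteq> \<Delta>" "\<Sum>\<^sub># (coords \<alpha>) = \<alpha>"
proof -
  obtain M where "set_mset M \<subseteq> \<Delta>" "\<Sum>\<^sub># M = \<alpha>"
    using positive_root_decomposition[OF assms] by blast
  then show "set_mset (coords \<alpha>) \<subseteq> \<Delta>" "\<Sum>\<^sub># (coords \<alpha>) = \<alpha>"
    using coords_eqI[of M \<alpha>] by simp_all
qed

lemma coords_nonempty: "\<alpha> \<in> P \<Longrightarrow> coords \<alpha> \<noteq> {#}"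
  using coords(2)[of \<alpha>] zero P_subset by force

text \<open>By linear independence the complex coordinates over \<Delta> are the multiplicities in
  \<open>coords \<alpha>\<close>, and for a vector in the span of \<open>I\<close> they agree with
  the coordinates over \<open>I\<close>, which vanish off \<open>I\<close>.\<close>

lemma coords_span:
  assumes \<alpha>: "\<alpha> \<in> P" and I: "I \<subseteq> \<Delta>" and span: "\<alpha> \<in> functional.span I"
  shows "set_mset (coords \<alpha>) \<subseteq> I"
proof
  fix \<delta> assume \<delta>: "\<delta> \<in># coords \<alpha>"
  let ?r = "functional.representation \<Delta>"
  have base: "\<epsilon> \<in> functional.span \<Delta>" if "\<epsilon> \<in> \<Delta>" for \<epsilon> using functional.span_base[OF that] .
  have "\<Sum>\<^sub># M \<in> functional.span \<Delta> \<and> ?r (\<Sum>\<^sub># M) \<delta> = of_nat (count M \<delta>)" if "set_mset M \<subseteq> \<Delta>" for M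
    using that
  proof (induction M)
    case empty
    show ?case
      unfolding sum_mset.empty functional.representation_zero
      by (intro conjI functional.span_zero) simp
  next
    case (add \<epsilon> M)
    then have \<epsilon>: "\<epsilon> \<in> \<Delta>" and M: "\<Sum>\<^sub># M \<in> functional.span \<Delta>"
      and IH: "?r (\<Sum>\<^sub># M) \<delta> = of_nat (count M \<delta>)" by auto
    have "?r (\<epsilon> + \<Sum>\<^sub># M) \<delta> = ?r \<epsilon> \<delta> + ?r (\<Sum>\<^sub># M) \<delta>"
      by (simp only: functional.representation_add[OF simple_independent M base[OF \<epsilon>]])
    also have "\<dots> = of_nat (count (add_mset \<epsilon> M) \<delta>)"
      unfolding IH functional.representation_basis[OF simple_independent \<epsilon>] by simp
    finally show ?case
      unfolding sum_mset.add_mset using functional.span_add[OF base[OF \<epsilon>] M] by blast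
  qed
  then have "?r \<alpha> \<delta> \<noteq> 0" using \<delta> coords[OF \<alpha>] by (metis count_eq_zero_iff of_nat_eq_0_iff)
  moreover have "?r \<alpha> = functional.representation I \<alpha>"
    by (rule functional.representation_extend[OF simple_independent span I])
  ultimately show "\<delta> \<in> I" using functional.representation_ne_zero by metis
qed

text \<open>The support of a root is connected: if \<open>\<alpha> = \<beta> + \<gamma>\<close> with \<open>\<beta>\<close> and \<open>\<gamma>\<close> orthogonal, then \<open>\<beta> - \<gamma>\<close> is a root
  as well, but its coordinates have both signs.\<close>

lemma coords_connected:
  assumes orth: "\<And>i j \<delta> \<epsilon>. i \<in> K \<Longrightarrow> j \<in> K \<Longrightarrow> i \<noteq> j \<Longrightarrow> \<delta> \<in> I i \<Longrightarrow> \<epsilon> \<in> I j \<Longrightarrow> \<delta> (T \<epsilon>) = 0"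
    and I: "\<And>i. i \<in> K \<Longrightarrow> I i \<subseteq> \<Delta>"
    and \<alpha>: "\<alpha> \<in> P" "set_mset (coords \<alpha>) \<subseteq> (\<Union>i\<in>K. I i)"
  shows "\<exists>i\<in>K. set_mset (coords \<alpha>) \<subseteq> I i"
  using \<alpha>
proof (induction "size (coords \<alpha>)" arbitrary: \<alpha> rule: less_induct)
  case less
  show ?case
  proof (cases "\<alpha> \<in> \<Delta>")
    case True
    then have "coords \<alpha> = {#\<alpha>#}" by (intro coords_eqI) auto
    then show ?thesis using less.prems by auto
  next
    case False
    then obtain \<beta> \<gamma> where bc: "\<alpha> = \<beta> + \<gamma>" "\<beta> \<in> P" "\<gamma> \<in> P"
      using less.prems by (auto simp: simple_roots_def)
    have c: "coords \<alpha> = coords \<beta> + coords \<gamma>"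
      by (rule coords_eqI) (use bc coords[OF bc(2)] coords[OF bc(3)] in auto)
    have "size (coords \<beta>) < size (coords \<alpha>)" "size (coords \<gamma>) < size (coords \<alpha>)"
      using c coords_nonempty[OF bc(2)] coords_nonempty[OF bc(3)] by (simp_all add: nonempty_has_size)
    then obtain i j where i: "i \<in> K" "set_mset (coords \<beta>) \<subseteq> I i"
      and j: "j \<in> K" "set_mset (coords \<gamma>) \<subseteq> I j"
      using less.hyps[of \<beta>] less.hyps[of \<gamma>] less.prems c bc(2,3) by auto
    show ?thesis
    proof (cases "i = j")
      case True
      then show ?thesis using i j c by auto
    next
      case False
      have in\<Phi>: "\<alpha> \<in> \<Phi>" "\<beta> \<in> \<Phi>" "\<gamma> \<in> \<Phi>" using bc less.prems P_subset by auto
      \<comment> \<open>If the difference were positive, the support of \<gamma>' would lie in that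
        of \<beta>'. A simple root in both would be orthogonal to itself. The primed names serve
        both signs of the difference.\<close>
      have mixed: False if "\<beta>' - \<gamma>' \<in> P" "\<beta>' \<in> P" "\<gamma>' \<in> P" "set_mset (coords \<beta>') \<subseteq> I i'"
        "set_mset (coords \<gamma>') \<subseteq> I j'" "i' \<in> K" "j' \<in> K" "i' \<noteq> j'" for \<beta>' \<gamma>' i' j'
      proof -
        have "coords \<beta>' = coords (\<beta>' - \<gamma>') + coords \<gamma>'"
          by (rule coords_eqI) (use coords[OF that(1)] coords[OF that(3)] in auto)
        moreover from coords_nonempty[OF that(3)] obtain \<delta> where d: "\<delta> \<in># coords \<gamma>'" by blast
        ultimately have "\<delta> \<in> I i'" "\<delta> \<in> I j'" using that(4,5) by auto
        then have "\<delta> (T \<delta>) = 0" using orth that(6-8) by blast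
        moreover have "\<delta> \<in> \<Phi>" using d coords(1)[OF that(3)] simple_subset P_subset by blast
        ultimately show False using norm_pos[of \<delta>] by simp
      qed
      \<comment> \<open>\<open>T\<close> is not assumed linear, so sums are expanded in the first
        argument only and \<open>commute\<close> exchanges the arguments.\<close>
      have "\<beta> (T \<delta>) = 0" if d: "\<delta> \<in># coords \<gamma>" for \<delta>
      proof -
        have "(\<Sum>\<epsilon>\<in>#coords \<beta>. \<epsilon> (T \<delta>)) = (\<Sum>\<epsilon>\<in>#coords \<beta>. 0)"
          by (intro arg_cong[where f=sum_mset] image_mset_cong orth[OF i(1) j(1) False])
            (use d i j in auto)
        then show ?thesis using coords(2)[OF bc(2)] by (simp flip: sum_mset_fun_apply)
      qed
      then have z: "\<delta> (T \<beta>) = 0" if d: "\<delta> \<in># coords \<gamma>" for \<delta>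
      proof -
        have "\<delta> \<in> \<Phi>" using d coords(1)[OF bc(3)] simple_subset P_subset by blast
        then show ?thesis using commute[OF _ in\<Phi>(2)] \<open>\<And>\<delta>. \<delta> \<in># coords \<gamma> \<Longrightarrow> \<beta> (T \<delta>) = 0\<close>[OF d] by simp
      qed
      have "(\<Sum>\<delta>\<in>#coords \<gamma>. \<delta> (T \<beta>)) = (\<Sum>\<delta>\<in>#coords \<gamma>. 0)"
        by (intro arg_cong[where f=sum_mset] image_mset_cong z)
      then have "\<gamma> (T \<beta>) = 0" using coords(2)[OF bc(3)] by (simp flip: sum_mset_fun_apply)
      then have "\<beta> (T \<gamma>) = 0" using commute[OF in\<Phi>(2,3)] by simp
      then have "\<beta> - \<gamma> \<in> \<Phi>" using orthogonal_root[OF in\<Phi>(2,3)] in\<Phi>(1) bc(1) by simp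
      then consider "\<beta> - \<gamma> \<in> P" | "\<gamma> - \<beta> \<in> P" using P_cases by force
      then show ?thesis
      proof cases
        case 1
        then show ?thesis using mixed[OF 1 bc(2,3) i(2) j(2) i(1) j(1) False] by blast
      next
        case 2
        then show ?thesis using mixed[OF 2 bc(3,2) j(2) i(2) j(1) i(1)] False by blast
      qed
    qed
  qed
qed

end

section \<open>Counting sets of roots with a given sum\<close>

lemma mem_sum_mset_image:
  assumes "finite S"
  shows "set_mset (\<Sum>q\<in>S. c q) = (\<Union>q\<in>S. set_mset (c q))"
  using assms by (induction S rule: finite_induct) auto

lemma sum_disjoint_multisets_unique:
  assumes K: "finite K" and disj: "\<And>i j. i \<in> K \<Longrightarrow> j \<in> K \<Longrightarrow> i \<noteq> j \<Longrightarrow> I i \<inter> I j = {}"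
    and M: "\<And>i. i \<in> K \<Longrightarrow> set_mset (M i) \<subseteq> I i" and N: "\<And>i. i \<in> K \<Longrightarrow> set_mset (N i) \<subseteq> I i"
    and eq: "(\<Sum>i\<in>K. M i) = (\<Sum>i\<in>K. N i)" and i: "i \<in> K"
  shows "M i = N i"
proof (rule multiset_eqI)
  fix b
  show "count (M i) b = count (N i) b"
  proof (cases "b \<in> I i")
    case True
    have *: "count (\<Sum>j\<in>K. L j) b = count (L i) b" if L: "\<And>j. j \<in> K \<Longrightarrow> set_mset (L j) \<subseteq> I j" for L
    proof -
      have "count (L j) b = 0" if "j \<in> K - {i}" for j
        using that True L[of j] disj[of i j] i by (auto simp: count_eq_zero_iff)
      then show ?thesis unfolding count_sum using sum.remove[OF K i, of "\<lambda>j. count (L j) b"] by simp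
    qed
    show ?thesis using *[of M] *[of N] M N eq by simp
  next
    case False
    then have "b \<notin># M i" "b \<notin># N i" using M[OF i] N[OF i] by auto
    then show ?thesis by (simp add: not_in_iff)
  qed
qed

text \<open>Taking unions is a bijection from the families of sets with the sums of the
  \<open>A i\<close> to the sets with the total sum; its inverse intersects with the elements
  supported in \<open>I i\<close>. Disjointness of the \<open>I i\<close> lets the total multiset be
  compared one part at a time.\<close>

lemma card_sum_multisets_product:
  fixes c :: "'q \<Rightarrow> 'b multiset"
  assumes Q: "finite Q" and K: "finite K"
    and disj: "\<And>i j. i \<in> K \<Longrightarrow> j \<in> K \<Longrightarrow> i \<noteq> j \<Longrightarrow> I i \<inter> I j = {}"
    and ne: "\<And>q. q \<in> Q \<Longrightarrow> c q \<noteq> {#}"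
    and conn: "\<And>q. q \<in> Q \<Longrightarrow> set_mset (c q) \<subseteq> (\<Union>i\<in>K. I i) \<Longrightarrow> \<exists>i\<in>K. set_mset (c q) \<subseteq> I i"
    and A: "\<And>i. i \<in> K \<Longrightarrow> A i \<subseteq> {q\<in>Q. set_mset (c q) \<subseteq> I i}"
  shows "card {X. X \<subseteq> Q \<and> (\<Sum>q\<in>X. c q) = (\<Sum>q\<in>(\<Union>i\<in>K. A i). c q)}
    = (\<Prod>i\<in>K. card {X. X \<subseteq> Q \<and> (\<Sum>q\<in>X. c q) = (\<Sum>q\<in>A i. c q)})"
proof -
  define W where "W X = (\<Sum>q\<in>X. c q)" for X
  define Qi where "Qi i = {q\<in>Q. set_mset (c q) \<subseteq> I i}" for i
  define S where "S i = {X. X \<subseteq> Q \<and> W X = W (A i)}" for i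
  define L where "L = {X. X \<subseteq> Q \<and> W X = W (\<Union>i\<in>K. A i)}"
  have W_set: "set_mset (W X) = (\<Union>q\<in>X. set_mset (c q))" if "X \<subseteq> Q" for X
    unfolding W_def by (rule mem_sum_mset_image[OF finite_subset[OF that Q]])
  have Qi_disj: "Qi i \<inter> Qi j = {}" if ij: "i \<in> K" "j \<in> K" "i \<noteq> j" for i j
  proof (rule ccontr)
    assume "Qi i \<inter> Qi j \<noteq> {}"
    then obtain q where q: "q \<in> Q" "set_mset (c q) \<subseteq> I i \<inter> I j" by (auto simp: Qi_def)
    then show False using disj[OF ij] ne by auto
  qed
  have W_Qi: "set_mset (W X) \<subseteq> I i" if "X \<subseteq> Qi i" for X i
    using that W_set[of X] unfolding Qi_def by auto
  have AQi: "A i \<subseteq> Qi i" if "i \<in> K" for i using A[OF that] by (simp add: Qi_def)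
  \<comment> \<open>Multiset sums do not cancel, so the support of each member is contained in that
    of the sum.\<close>
  have S_Qi: "X \<subseteq> Qi i" if "i \<in> K" "X \<in> S i" for i X
  proof
    fix q assume q: "q \<in> X"
    have X: "X \<subseteq> Q" "W X = W (A i)" using that by (simp_all add: S_def)
    have "set_mset (c q) \<subseteq> set_mset (W X)" using W_set[OF X(1)] q by blast
    also have "\<dots> \<subseteq> I i" unfolding X(2) by (rule W_Qi[OF AQi[OF that(1)]])
    finally show "q \<in> Qi i" using q X(1) by (auto simp: Qi_def)
  qed
  have W_Union: "W (\<Union>i\<in>K. f i) = (\<Sum>i\<in>K. W (f i))" if f: "\<And>i. i \<in> K \<Longrightarrow> f i \<subseteq> Qi i" for f
  proof -
    have "finite (f i)" if "i \<in> K" for i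
      using f[OF that] Q by (auto simp: Qi_def intro: finite_subset)
    moreover have "f i \<inter> f j = {}" if "i \<in> K" "j \<in> K" "i \<noteq> j" for i j
      using Qi_disj[OF that] f[OF that(1)] f[OF that(2)] by blast
    ultimately show ?thesis unfolding W_def by (intro sum.UNION_disjoint[OF K]) auto
  qed
  have "bij_betw (\<lambda>f. \<Union>i\<in>K. f i) (PiE K S) L"
  proof (rule bij_betw_imageI)
    have inter: "(\<Union>j\<in>K. f j) \<inter> Qi i = f i" if "f \<in> PiE K S" "i \<in> K" for f i
    proof -
      have "f j \<subseteq> Qi j" if "j \<in> K" for j using S_Qi[OF that] \<open>f \<in> PiE K S\<close> that by (auto simp: PiE_iff)
      then show ?thesis using Qi_disj \<open>i \<in> K\<close> by blast
    qed
    show "inj_on (\<lambda>f. \<Union>i\<in>K. f i) (PiE K S)"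
    proof (rule inj_onI)
      fix f g assume fg: "f \<in> PiE K S" "g \<in> PiE K S" "(\<Union>i\<in>K. f i) = (\<Union>i\<in>K. g i)"
      have "f i = g i" if "i \<in> K" for i
        using inter[OF fg(1) that] inter[OF fg(2) that] fg(3) by simp
      then show "f = g" by (intro PiE_ext[OF fg(1,2)])
    qed
    show "(\<lambda>f. \<Union>i\<in>K. f i) ` PiE K S = L"
    proof (intro equalityI subsetI)
      fix X assume "X \<in> (\<lambda>f. \<Union>i\<in>K. f i) ` PiE K S"
      then obtain f where f: "f \<in> PiE K S" "X = (\<Union>i\<in>K. f i)" by blast
      have fS: "f i \<in> S i" if "i \<in> K" for i using f(1) that by (auto simp: PiE_iff)
      have "W X = (\<Sum>i\<in>K. W (f i))" unfolding f(2) by (rule W_Union) (use S_Qi fS in blast)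
      also have "\<dots> = (\<Sum>i\<in>K. W (A i))" by (rule sum.cong) (use fS in \<open>auto simp: S_def\<close>)
      also have "\<dots> = W (\<Union>i\<in>K. A i)" using W_Union[of A] AQi by simp
      finally show "X \<in> L" using f(2) fS by (auto simp: L_def S_def)
    next
      fix X assume "X \<in> L"
      then have X: "X \<subseteq> Q" "W X = W (\<Union>i\<in>K. A i)" by (simp_all add: L_def)
      \<comment> \<open>The restriction to \<open>K\<close> makes \<open>f\<close> extensional, as
        \<open>PiE\<close> demands.\<close>
      define f where "f = (\<lambda>i\<in>K. X \<inter> Qi i)"
      have "X \<subseteq> (\<Union>i\<in>K. Qi i)"
      proof
        fix q assume q: "q \<in> X"
        have "(\<Union>i\<in>K. A i) \<subseteq> Q" using AQi by (auto simp: Qi_def)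
        then have "set_mset (W (\<Union>i\<in>K. A i)) \<subseteq> (\<Union>i\<in>K. I i)"
          using W_set[of "\<Union>i\<in>K. A i"] AQi by (fastforce simp: Qi_def)
        moreover have "set_mset (c q) \<subseteq> set_mset (W X)" using W_set[OF X(1)] q by blast
        ultimately have "set_mset (c q) \<subseteq> (\<Union>i\<in>K. I i)" unfolding X(2) by blast
        then show "q \<in> (\<Union>i\<in>K. Qi i)" using conn[of q] q X(1) by (auto simp: Qi_def)
      qed
      then have UX: "(\<Union>i\<in>K. f i) = X" by (auto simp: f_def)
      have fQi: "f i \<subseteq> Qi i" if "i \<in> K" for i using that by (simp add: f_def)
      have eq: "(\<Sum>i\<in>K. W (f i)) = (\<Sum>i\<in>K. W (A i))"
        using W_Union[of f] W_Union[of A] fQi AQi UX X(2) by simp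
      have "W (f i) = W (A i)" if i: "i \<in> K" for i
      proof (rule sum_disjoint_multisets_unique[OF K disj])
        show "set_mset (W (f i)) \<subseteq> I i" "set_mset (W (A i)) \<subseteq> I i" if "i \<in> K" for i
          by (rule W_Qi[OF fQi[OF that]], rule W_Qi[OF AQi[OF that]])
      qed (use i eq in simp_all)
      then have "f \<in> PiE K S"
        using fQi X(1) by (auto simp: S_def f_def Qi_def)
      then show "X \<in> (\<lambda>f. \<Union>i\<in>K. f i) ` PiE K S" using UX by blast
    qed
  qed
  then have "card L = card (PiE K S)" by (simp add: bij_betw_same_card)
  also have "\<dots> = (\<Prod>i\<in>K. card (S i))" by (rule card_PiE[OF K])
  finally show ?thesis by (simp add: L_def S_def W_def)
qed

lemma (in positive_roots) sum_eq_iff_coords: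
  assumes "X \<subseteq> P" "Y \<subseteq> P"
  shows "(\<forall>x. (\<Sum>\<alpha>\<in>X. \<alpha> x) = (\<Sum>\<alpha>\<in>Y. \<alpha> x)) \<longleftrightarrow> (\<Sum>\<alpha>\<in>X. coords \<alpha>) = (\<Sum>\<alpha>\<in>Y. coords \<alpha>)"
proof -
  have s: "\<Sum>\<^sub># (\<Sum>\<alpha>\<in>Z. coords \<alpha>) = (\<Sum>\<alpha>\<in>Z. \<alpha>)" and d: "set_mset (\<Sum>\<alpha>\<in>Z. coords \<alpha>) \<subseteq> \<Delta>"
    if Z: "Z \<subseteq> P" for Z
  proof -
    have fin: "finite Z" using Z finite_P by (rule finite_subset)
    show "\<Sum>\<^sub># (\<Sum>\<alpha>\<in>Z. coords \<alpha>) = (\<Sum>\<alpha>\<in>Z. \<alpha>)"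
      using fin Z by (induction Z rule: finite_induct) (simp_all add: coords(2))
    show "set_mset (\<Sum>\<alpha>\<in>Z. coords \<alpha>) \<subseteq> \<Delta>"
      unfolding mem_sum_mset_image[OF fin] using coords(1) Z by blast
  qed
  have "(\<forall>x. (\<Sum>\<alpha>\<in>X. \<alpha> x) = (\<Sum>\<alpha>\<in>Y. \<alpha> x)) \<longleftrightarrow> (\<Sum>\<alpha>\<in>X. \<alpha>) = (\<Sum>\<alpha>\<in>Y. \<alpha>)"
    by (simp add: fun_eq_iff sum_fun_apply)
  also have "\<dots> \<longleftrightarrow> (\<Sum>\<alpha>\<in>X. coords \<alpha>) = (\<Sum>\<alpha>\<in>Y. coords \<alpha>)"
    unfolding s[OF assms(1), symmetric] s[OF assms(2), symmetric]
    using simple_multiset_unique[OF d[OF assms(1)] d[OF assms(2)]] by auto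
  finally show ?thesis .
qed

text \<open>The weight of a subset is half the sum of all roots in
  \<open>pos_roots_q \<tt> \<hh> P\<close> minus the sum over the subset.\<close>

lemma spin_weight_eq_iff:
  assumes Q: "finite (pos_roots_q \<tt> \<hh> P)" and X: "X \<subseteq> pos_roots_q \<tt> \<hh> P" and Y: "Y \<subseteq> pos_roots_q \<tt> \<hh> P"
  shows "spin_weight \<tt> \<hh> P X = spin_weight \<tt> \<hh> P Y \<longleftrightarrow> (\<forall>x. (\<Sum>\<alpha>\<in>X. \<alpha> x) = (\<Sum>\<alpha>\<in>Y. \<alpha> x))"
proof -
  have "spin_weight \<tt> \<hh> P Z x = 1/2 * (\<Sum>\<alpha>\<in>pos_roots_q \<tt> \<hh> P. \<alpha> x) - (\<Sum>\<alpha>\<in>Z. \<alpha> x)"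
    if "Z \<subseteq> pos_roots_q \<tt> \<hh> P" for Z x
    unfolding spin_weight_def
    using sum_diff[OF Q that, of "\<lambda>\<alpha>. \<alpha> x"] by (simp add: right_diff_distrib)
  then show ?thesis using X Y by (auto simp: fun_eq_iff)
qed

text \<open>The two closure properties are contrapositives of \<open>root_ray\<close>: a positive
  inner product, or orthogonality with a sum that is a root, forces the difference to be a weight.
  The two roots are distinct, so it is a root.\<close>

lemma (in semisimple_cartan) positive_roots_killing:
  assumes P: "positive_system (roots \<tt> UNIV) P"
  shows "positive_roots (roots \<tt> UNIV) P (killing_rep \<tt>)"
proof
  let ?\<Phi> = "roots \<tt> UNIV" and ?T = "killing_rep \<tt>"
  show "positive_system ?\<Phi> P" by fact
  show "finite P" using P finite_roots by (auto simp: positive_system_def intro: finite_subset)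
  show "0 \<notin> ?\<Phi>" by (simp add: roots_def)
  show "\<alpha> (?T \<beta>) \<in> \<rat>" if "\<alpha> \<in> ?\<Phi>" "\<beta> \<in> ?\<Phi>" for \<alpha> \<beta>
    by (rule root_killing_rep_rational[OF that(2,1)])
  show "\<alpha> (?T \<beta>) = \<beta> (?T \<alpha>)" if "\<alpha> \<in> ?\<Phi>" "\<beta> \<in> ?\<Phi>" for \<alpha> \<beta>
    by (rule root_killing_rep_commute[OF that])
  show "\<Sum>\<^sub># M = 0" if "set_mset M \<subseteq> ?\<Phi>" "Re (\<Sum>\<beta>\<in>#M. (\<Sum>\<^sub># M) (?T \<beta>)) \<le> 0" for M
    by (rule form_definite[OF that])
  show "\<alpha> - \<beta> \<in> ?\<Phi>" if ab: "\<alpha> \<in> ?\<Phi>" "\<beta> \<in> ?\<Phi>" and pos: "Re (\<alpha> (?T \<beta>)) > 0" and "\<alpha> \<noteq> \<beta>" for \<alpha> \<beta>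
  proof -
    have "\<alpha> - \<beta> \<in> wt ` B"
    proof (rule ccontr)
      assume "\<alpha> - \<beta> \<notin> wt ` B"
      then have "\<alpha> (?T \<beta>) = 0" using root_ray[OF ab] pos by simp
      then show False using pos by simp
    qed
    moreover have "\<alpha> - \<beta> \<noteq> 0" using \<open>\<alpha> \<noteq> \<beta>\<close> by (simp only: right_minus_eq not_False_eq_True)
    ultimately show ?thesis unfolding roots_iff by blast
  qed
  show "\<alpha> - \<beta> \<in> ?\<Phi>" if ab: "\<alpha> \<in> ?\<Phi>" "\<beta> \<in> ?\<Phi>" and orth: "\<alpha> (?T \<beta>) = 0" and sum: "\<alpha> + \<beta> \<in> ?\<Phi>" for \<alpha> \<beta>
  proof -
    have "\<alpha> + \<beta> \<in> wt ` B" using sum unfolding roots_iff by blast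
    then have "\<alpha> - \<beta> \<in> wt ` B" using root_ray[OF ab] orth by auto
    moreover have "\<alpha> \<noteq> \<beta>" using root_norm_pos[OF ab(2)] orth by auto
    then have "\<alpha> - \<beta> \<noteq> 0" by (simp only: right_minus_eq not_False_eq_True)
    ultimately show ?thesis unfolding roots_iff by blast
  qed
qed


theorem proposition2p5:
  fixes \<tt> \<hh> :: "'g::fd_complex_lie_algebra set"
    and P \<Delta> A :: "('g \<Rightarrow> complex) set"
    and k :: nat
    and I As :: "nat \<Rightarrow> ('g \<Rightarrow> complex) set"
  assumes "semisimple_lie TYPE('g)"
    and "cartan_subalgebra \<tt>"
    and "levi_subalgebra \<hh>"
    and "\<tt> \<subseteq> \<hh>"
    and "positive_system (roots \<tt> UNIV) P"
    and "\<Delta> = simple_roots P"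
    and "\<And>j. j \<in> {1..k} \<Longrightarrow> I j \<subseteq> \<Delta>"
    and "\<And>i j \<alpha> \<beta>. i \<in> {1..k} \<Longrightarrow> j \<in> {1..k} \<Longrightarrow> i \<noteq> j \<Longrightarrow>
           \<alpha> \<in> I i \<Longrightarrow> \<beta> \<in> I j \<Longrightarrow> dual_form \<tt> \<alpha> \<beta> = 0"
    and "\<And>j. j \<in> {1..k} \<Longrightarrow> As j \<subseteq> pos_roots_q_span \<tt> \<hh> P (I j)"
    and "A = (\<Union>j\<in>{1..k}. As j)"
  shows "spin_mult \<tt> \<hh> P (spin_weight \<tt> \<hh> P A)
           = (\<Prod>j\<in>{1..k}. spin_mult \<tt> \<hh> P (spin_weight \<tt> \<hh> P (As j)))"
proof -
  interpret cartan \<tt> by unfold_locales (rule assms(2))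
  obtain B wt where "cvec.independent B \<and> cvec.span B = UNIV \<and>
     (\<forall>b\<in>B. wt b \<in> dual \<tt> \<and> b \<in> weight_space \<tt> (wt b))"
    using weight_basis_exists by (elim exE)
  then interpret semisimple_cartan \<tt> B wt
    by unfold_locales (use assms(1) in auto)
  interpret positive_roots "roots \<tt> UNIV" P "killing_rep \<tt>"
    by (rule positive_roots_killing[OF assms(5)])
  let ?Q = "pos_roots_q \<tt> \<hh> P" and ?K = "{1..k}"
  have QP: "?Q \<subseteq> P" by (auto simp: pos_roots_q_def)
  then have finQ: "finite ?Q" using finite_P by (rule finite_subset)
  have I: "I i \<subseteq> simple_roots P" if "i \<in> ?K" for i using assms(6,7) that by simp
  have I\<Phi>: "I i \<subseteq> roots \<tt> UNIV" if "i \<in> ?K" for i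
    using I[OF that] simple_subset P_subset by blast
  have orth: "\<delta> (killing_rep \<tt> \<epsilon>) = 0"
    if "i \<in> ?K" "j \<in> ?K" "i \<noteq> j" "\<delta> \<in> I i" "\<epsilon> \<in> I j" for i j \<delta> \<epsilon>
  proof -
    have "\<delta> \<in> roots \<tt> UNIV" "\<epsilon> \<in> roots \<tt> UNIV" using I\<Phi> that by blast+
    from dual_form_root[OF this] show ?thesis using assms(8)[OF that] by simp
  qed
  \<comment> \<open>A common simple root would be orthogonal to itself.\<close>
  have disj: "I i \<inter> I j = {}" if ij: "i \<in> ?K" "j \<in> ?K" "i \<noteq> j" for i j
  proof (rule ccontr)
    assume "I i \<inter> I j \<noteq> {}"
    then obtain \<delta> where \<delta>: "\<delta> \<in> I i" "\<delta> \<in> I j" by blast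
    then have "\<delta> \<in> roots \<tt> UNIV" using I\<Phi>[OF ij(1)] by blast
    from norm_pos[OF this] show False using orth[OF ij \<delta>] by simp
  qed
  have As: "As i \<subseteq> {\<alpha>\<in>?Q. set_mset (coords \<alpha>) \<subseteq> I i}" if "i \<in> ?K" for i
  proof
    fix \<alpha> assume "\<alpha> \<in> As i"
    then have "\<alpha> \<in> P" "\<alpha> \<in> functional.span (I i)" "\<alpha> \<in> ?Q"
      using assms(9)[OF that] by (auto simp: pos_roots_q_span_def)
    then show "\<alpha> \<in> {\<alpha>\<in>?Q. set_mset (coords \<alpha>) \<subseteq> I i}"
      using coords_span[OF _ I[OF that]] by simp
  qed
  \<comment> \<open>From here on only multiset sums of coordinates are counted.\<close>
  have mult: "spin_mult \<tt> \<hh> P (spin_weight \<tt> \<hh> P Y)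
      = card {X. X \<subseteq> ?Q \<and> (\<Sum>\<alpha>\<in>X. coords \<alpha>) = (\<Sum>\<alpha>\<in>Y. coords \<alpha>)}" if Y: "Y \<subseteq> ?Q" for Y
  proof -
    have "spin_weight \<tt> \<hh> P X = spin_weight \<tt> \<hh> P Y \<longleftrightarrow>
        (\<Sum>\<alpha>\<in>X. coords \<alpha>) = (\<Sum>\<alpha>\<in>Y. coords \<alpha>)" if X: "X \<subseteq> ?Q" for X
      using spin_weight_eq_iff[OF finQ X Y] sum_eq_iff_coords[of X Y] X Y QP by auto
    then show ?thesis unfolding spin_mult_def by (intro arg_cong[where f=card]) blast
  qed
  have AsQ: "As j \<subseteq> ?Q" if "j \<in> ?K" for j using As[OF that] by blast
  then have AQ: "A \<subseteq> ?Q" using assms(10) by blast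
  have "card {X. X \<subseteq> ?Q \<and> (\<Sum>\<alpha>\<in>X. coords \<alpha>) = (\<Sum>\<alpha>\<in>(\<Union>j\<in>?K. As j). coords \<alpha>)}
      = (\<Prod>j\<in>?K. card {X. X \<subseteq> ?Q \<and> (\<Sum>\<alpha>\<in>X. coords \<alpha>) = (\<Sum>\<alpha>\<in>As j. coords \<alpha>)})"
  proof (rule card_sum_multisets_product[OF finQ _ disj _ _ As])
    show "coords \<alpha> \<noteq> {#}" if "\<alpha> \<in> ?Q" for \<alpha> using coords_nonempty[of \<alpha>] that QP by blast
    show "\<exists>i\<in>?K. set_mset (coords \<alpha>) \<subseteq> I i"
      if \<alpha>: "\<alpha> \<in> ?Q" "set_mset (coords \<alpha>) \<subseteq> (\<Union>i\<in>?K. I i)" for \<alpha>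
    proof (rule coords_connected)
      show "\<delta> (killing_rep \<tt> \<epsilon>) = 0"
        if "i \<in> ?K" "j \<in> ?K" "i \<noteq> j" "\<delta> \<in> I i" "\<epsilon> \<in> I j" for i j \<delta> \<epsilon>
        by (rule orth[OF that])
    qed (use \<alpha> QP I in auto)
  qed auto
  also have "\<dots> = (\<Prod>j\<in>?K. spin_mult \<tt> \<hh> P (spin_weight \<tt> \<hh> P (As j)))"
    by (rule prod.cong) (use mult AsQ in simp_all)
  finally show ?thesis using mult[OF AQ] unfolding assms(10) by (rule trans[rotated])
qed

end
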